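(* Let $d\in\{2,3\}$, $\tau>0$, $\alpha>0$, and let $\Gamma_h^0,\Gamma_h^1,\dots,\Gamma_h^N$ be closed discrete surfaces (curves if $d=2$) in $\mathbb{R}^d$ such that for each $m=1,\dots,N$ one has $\Gamma_h^m=X_h^m(\Gamma_h^{m-1})$ with $X_h^m=\mathrm{id}+\tau v_h^m$, where $(v_h^m,\lambda_h^m,c^m)\in (S_h^{m-1})^d\times S_h^{m-1}\times\mathbb{R}$ is the numerical solution of surface diffusion, i.e. for all $\eta_h\in (S_h^{m-1})^d$ and all $\chi_h\in S_h^{m-1}$: $$\int_{\Gamma_h^{m-1}} \nabla_{\Gamma_h^{m-1}}(\tau v_h^m+\mathrm{id})\cdot\nabla_{\Gamma_h^{m-1}}\eta_h-(\lambda_h^m n_h^{m-1},\eta_h)^{(h)}-c^m(T_h^{m-1},\eta_h)^{(h)}=0,$$ $$(v_h^m\cdot n_h^{m-1},\chi_h)^{(h)}+\int_{\Gamma_h^{m-1}}\nabla_{\Gamma_h^{m-1}}\lambda_h^m\cdot\nabla_{\Gamma_h^{m-1}}\chi_h=0,$$ $$(v_h^m,T_h^{m-1})^{(h)}+\alpha c^m\|T_h^{m-1}\|_{L^2_h}=0.$$ Then $$|\Gamma_h^m|\le|\Gamma_h^{m-1}|\qquad\text{for } m=1,2,\dots,N,$$ where $|\Gamma_h^m|$ denotes the area (length if $d=2$) of $\Gamma_h^m$.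
   Context: Each $\Gamma_h^{m-1}$ is a closed (without boundary) oriented polyhedral hypersurface in $\mathbb{R}^d$: a finite union of nondegenerate simplices (flat triangles if $d=3$, straight segments if $d=2$) meeting conformingly along common faces. $S_h^{m-1}$ is the space of continuous real functions on $\Gamma_h^{m-1}$ that are linear (affine) on each simplex. $n_h^{m-1}$ is the piecewise constant unit normal (consistently oriented). $\mathrm{id}$ is the identity map of $\Gamma_h^{m-1}$; $\nabla_{\Gamma_h^{m-1}}$ is the elementwise tangential gradient, acting componentwise on vector fields, and $\cdot$ between gradients of vector fields is the Frobenius product. The simplices of $\Gamma_h^m$ are the images under the piecewise linear map $X_h^m$ of the simplices of $\Gamma_h^{m-1}$, and $|\Gamma_h^m|$ is the sum of the $\mathcal{H}^{d-1}$-measures of its simplices. Mass lumping on $\Gamma_h^{m-1}$: for functions $\eta,\chi$ that are continuous on each simplex (possibly jumping across simplices), $$(\eta,\chi)^{(h)}=\frac1d\sum_{l}|\sigma_l|\sum_{k=1}^d(\eta\cdot\chi)\bigl((\vec q_{l,k})^-\bigr),$$ where $\sigma_l$ runs over the (relatively open) simplices, $|\sigma_l|=\mathcal{H}^{d-1}(\sigma_l)$, $\vec q_{l,1},\dots,\vec q_{l,d}$ are the vertices of $\sigma_l$, and $(\vec q_{l,k})^-$ denotes the limit taken from inside $\sigma_l$; for vector-valued arguments the product is the Euclidean inner product. $\|f\|_{L^2_h}=\sqrt{(f,f)^{(h)}}$. The vector $T_h^{m-1}\in (S_h^{m-1})^d$ is defined by the problem: find $(T_h^{m-1},\mu_h^{m-1})\in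 (S_h^{m-1})^d\times S_h^{m-1}$ with $$(T_h^{m-1},\eta_h)^{(h)}+(\mu_h^{m-1}n_h^{m-1},\eta_h)^{(h)}=\int_{\Gamma_h^{m-1}}\nabla_{\Gamma_h^{m-1}}\mathrm{id}\cdot\nabla_{\Gamma_h^{m-1}}\eta_h\quad\forall\eta_h\in (S_h^{m-1})^d,$$ $$(T_h^{m-1},n_h^{m-1}\chi_h)^{(h)}=0\quad\forall\chi_h\in S_h^{m-1}.$$ *)

theory Defs
  imports "HOL-Analysis.Analysis"
begin

text \<open>The normalisation by the volume of the unit ball makes the \<open>k\<close>-dimensional measure agree
  with the usual \<open>k\<close>-dimensional area. Boundedness is demanded explicitly because
  \<^const>\<open>diameter\<close> is an unspecified real number on unbounded sets; the case distinction only
  matters for \<open>k = 0\<close>, where \<open>0 ^ 0 = 1\<close>.\<close>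

definition hausdorff_pre :: "nat \<Rightarrow> real \<Rightarrow> 'a::metric_space set \<Rightarrow> ennreal" where
  "hausdorff_pre k \<delta> A =
     Inf {(\<Sum>i. if U i = {} then 0
                else ennreal (unit_ball_vol (real k) * (diameter (U i) / 2) ^ k)) | U :: nat \<Rightarrow> 'a set.
          A \<subseteq> (\<Union>i. U i) \<and> (\<forall>i. bounded (U i) \<and> diameter (U i) \<le> \<delta>)}"

definition hausdorff_outer :: "nat \<Rightarrow> 'a::metric_space set \<Rightarrow> ennreal" where
  "hausdorff_outer k A = (SUP \<delta>\<in>{0<..}. hausdorff_pre k \<delta> A)"

text \<open>As a metric outer measure, \<open>hausdorff_outer k\<close> is countably additive on Borel sets.\<close>

definition hausdorff_measure :: "nat \<Rightarrow> 'a::metric_space measure" where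
  "hausdorff_measure k = measure_of UNIV (sets borel) (hausdorff_outer k)"

text \<open>A surface is given by the set \<open>\<G>\<close> of its closed simplices; the underlying point set is
  \<open>\<Union>\<G>\<close>. The ambient dimension \<open>d\<close> is \<open>CARD('n)\<close>. Conformity is part of
  \<^const>\<open>triangulation\<close>, and the absence of boundary says that each facet of a simplex belongs
  to exactly two simplices.\<close>

definition closed_polyhedral_hypersurface :: "(real^'n) set set \<Rightarrow> bool" where
  "closed_polyhedral_hypersurface \<G> \<longleftrightarrow>
     triangulation \<G> \<and>
     (\<forall>\<sigma>\<in>\<G>. (int CARD('n) - 1) simplex \<sigma>) \<and>
     (\<forall>\<sigma>\<in>\<G>. \<forall>F. F facet_of \<sigma> \<longrightarrow> card {\<sigma>'\<in>\<G>. F facet_of \<sigma>'} = 2)"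

definition vertices :: "(real^'n) set \<Rightarrow> (real^'n) set" where
  "vertices \<sigma> = {q. q extreme_point_of \<sigma>}"

definition tangent_space :: "(real^'n) set \<Rightarrow> (real^'n) set" where
  "tangent_space \<sigma> = span {x - y | x y. x \<in> \<sigma> \<and> y \<in> \<sigma>}"

text \<open>A piecewise constant unit normal field is a function on points which is constant on the
  relative interior of each simplex; its values on common faces are irrelevant.

  Orientation: if \<open>\<sigma>\<close> and \<open>\<sigma>'\<close> share the facet \<open>F\<close> and have opposite vertices \<open>p\<close>, \<open>p'\<close>, then
  there is exactly one linear map that fixes the directions of \<open>F\<close>, carries the edges from \<open>F\<close> to
  \<open>p\<close> to those from \<open>F\<close> to \<open>p'\<close>, and carries the normal of \<open>\<sigma>\<close> to that of \<open>\<sigma>'\<close>. The normals are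
  consistent across \<open>F\<close> if and only if it reverses the orientation of the ambient space (for
  coplanar neighbours on opposite sides of \<open>F\<close> with equal normals it is a skew reflection).\<close>

definition oriented_unit_normal :: "(real^'n) set set \<Rightarrow> (real^'n \<Rightarrow> real^'n) \<Rightarrow> bool" where
  "oriented_unit_normal \<G> n \<longleftrightarrow>
     (\<forall>\<sigma>\<in>\<G>. \<forall>x\<in>rel_interior \<sigma>.
        norm (n x) = 1 \<and> (\<forall>t\<in>tangent_space \<sigma>. n x \<bullet> t = 0) \<and>
        (\<forall>y\<in>rel_interior \<sigma>. n y = n x)) \<and>
     (\<forall>\<sigma>\<in>\<G>. \<forall>\<sigma>'\<in>\<G>. \<forall>F p p' x x'.
        \<sigma> \<noteq> \<sigma>' \<and> F facet_of \<sigma> \<and> F facet_of \<sigma>' \<and>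
        p \<in> vertices \<sigma> - F \<and> p' \<in> vertices \<sigma>' - F \<and>
        x \<in> rel_interior \<sigma> \<and> x' \<in> rel_interior \<sigma>' \<longrightarrow>
        (\<exists>A :: real^'n^'n.
           (\<forall>a\<in>F. \<forall>b\<in>F. A *v (a - b) = a - b) \<and>
           (\<forall>a\<in>F. A *v (p - a) = p' - a) \<and>
           A *v n x = n x' \<and> det A < 0))"

definition simplex_area :: "(real^'n) set \<Rightarrow> real" where
  "simplex_area \<sigma> = measure (hausdorff_measure (CARD('n) - 1)) \<sigma>"

definition surface_area :: "(real^'n) set set \<Rightarrow> real" where
  "surface_area \<G> = (\<Sum>\<sigma>\<in>\<G>. simplex_area \<sigma>)"

text \<open>Elements of these spaces are functions on the whole space of which only the restriction to
  \<open>\<Union>\<G>\<close> matters.\<close>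

definition Sh :: "(real^'n) set set \<Rightarrow> (real^'n \<Rightarrow> real) set" where
  "Sh \<G> = {f. continuous_on (\<Union>\<G>) f \<and> (\<forall>\<sigma>\<in>\<G>. \<exists>a b. \<forall>x\<in>\<sigma>. f x = a \<bullet> x + b)}"

definition Sh_vec :: "(real^'n) set set \<Rightarrow> (real^'n \<Rightarrow> real^'n) set" where
  "Sh_vec \<G> = {f. \<forall>i. (\<lambda>x. f x $ i) \<in> Sh \<G>}"

definition tangential_gradient ::
    "(real^'n) set \<Rightarrow> (real^'n \<Rightarrow> real) \<Rightarrow> real^'n \<Rightarrow> real^'n" where
  "tangential_gradient \<sigma> f x =
     (THE g. g \<in> tangent_space \<sigma> \<and> (f has_derivative (\<lambda>h. g \<bullet> h)) (at x within \<sigma>))"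

definition grad_form ::
    "(real^'n) set set \<Rightarrow> (real^'n \<Rightarrow> real) \<Rightarrow> (real^'n \<Rightarrow> real) \<Rightarrow> real" where
  "grad_form \<G> f g =
     (\<Sum>\<sigma>\<in>\<G>. LINT x:\<sigma>|hausdorff_measure (CARD('n) - 1).
        tangential_gradient \<sigma> f x \<bullet> tangential_gradient \<sigma> g x)"

definition grad_form_vec ::
    "(real^'n) set set \<Rightarrow> (real^'n \<Rightarrow> real^'n) \<Rightarrow> (real^'n \<Rightarrow> real^'n) \<Rightarrow> real" where
  "grad_form_vec \<G> f g =
     (\<Sum>\<sigma>\<in>\<G>. LINT x:\<sigma>|hausdorff_measure (CARD('n) - 1).
        (\<Sum>i\<in>UNIV. tangential_gradient \<sigma> (\<lambda>y. f y $ i) x \<bullet> tangential_gradient \<sigma> (\<lambda>y. g y $ i) x))"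

text \<open>For real-valued arguments \<open>\<bullet>\<close> is multiplication.\<close>

definition lumped ::
    "(real^'n) set set \<Rightarrow> (real^'n \<Rightarrow> 'b::real_inner) \<Rightarrow> (real^'n \<Rightarrow> 'b) \<Rightarrow> real" where
  "lumped \<G> \<eta> \<xi> =
     (1 / real CARD('n)) *
     (\<Sum>\<sigma>\<in>\<G>. simplex_area \<sigma> *
        (\<Sum>q\<in>vertices \<sigma>. Lim (at q within rel_interior \<sigma>) (\<lambda>x. \<eta> x \<bullet> \<xi> x)))"

definition lumped_norm :: "(real^'n) set set \<Rightarrow> (real^'n \<Rightarrow> 'b::real_inner) \<Rightarrow> real" where
  "lumped_norm \<G> f = sqrt (lumped \<G> f f)"

definition is_Th ::
    "(real^'n) set set \<Rightarrow> (real^'n \<Rightarrow> real^'n) \<Rightarrow> (real^'n \<Rightarrow> real^'n) \<Rightarrow> bool" where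
  "is_Th \<G> n T \<longleftrightarrow>
     T \<in> Sh_vec \<G> \<and>
     (\<exists>\<mu>\<in>Sh \<G>.
        (\<forall>\<eta>\<in>Sh_vec \<G>.
           lumped \<G> T \<eta> + lumped \<G> (\<lambda>x. \<mu> x *\<^sub>R n x) \<eta> = grad_form_vec \<G> (\<lambda>x. x) \<eta>) \<and>
        (\<forall>\<xi>\<in>Sh \<G>. lumped \<G> T (\<lambda>x. \<xi> x *\<^sub>R n x) = 0))"

end

theory Submission
  imports Defs
begin

text \<open>The scheme decreases area because it treats the position implicitly. Testing the first equation
  with \<open>v\<close>, the second with \<open>\<lambda>\<close> and multiplying the third by \<open>c\<close> gives, with \<open>X = id + \<tau> v\<close>,

  \<open>\<integral> \<nabla>X \<cdot> \<nabla>v = - \<integral> \<bar>\<nabla>\<lambda>\<bar>\<^sup>2 - \<alpha> c\<^sup>2 \<parallel>T\<parallel> \<le> 0\<close>.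

  It remains to bound the growth of area by the left-hand side,
  \<open>\<bar>X(\<Gamma>)\<bar> - \<bar>\<Gamma>\<bar> \<le> \<integral> \<nabla>X \<cdot> \<nabla>(X - id) = \<tau> \<integral> \<nabla>X \<cdot> \<nabla>v\<close>, and this is done on each
  simplex (\<open>simplex_area_moved_le\<close>). All gradients are constant there. With \<open>k = d - 1\<close> and \<open>J\<close> the
  factor by which \<open>X\<close> changes area, the arithmetic-geometric mean inequality gives
  \<open>J \<le> 1 + (\<bar>\<nabla>X\<bar>\<^sup>2 - k) / 2\<close> when \<open>k \<le> 2\<close>. Since \<open>\<bar>\<nabla>id\<bar>\<^sup>2 = k\<close>, convexity of the square yields the claim.

  The remaining work is measure theoretic: areas are Hausdorff measures in \<open>\<real>\<^sup>d\<close>, and the factor \<open>J\<close> has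
  to be identified as a determinant (\<open>simplex_area_affine_image\<close>). The Hausdorff outer measure is
  additive on separated sets, hence a measure on Borel sets (\<open>measure_space_hausdorff_outer\<close>). It is
  preserved by isometries between different spaces, so that a simplex and its image may be flattened to
  subsets of \<open>\<real>\<^sup>k\<close>. On \<open>\<real>\<^sup>k\<close> it is translation invariant and finite on cubes, thus a multiple of
  Lebesgue measure (\<open>hausdorff_measure_eq_scaled_lborel\<close>), and linear maps scale it by the modulus of
  their determinant. The value of the multiple cancels.\<close>

section \<open>The Hausdorff outer measure is a measure on Borel sets\<close>

definition hausdorff_gauge :: "nat \<Rightarrow> 'a::metric_space set \<Rightarrow> ennreal" where
  "hausdorff_gauge k U =
     (if U = {} then 0 else ennreal (unit_ball_vol (real k) * (diameter U / 2) ^ k))"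

lemma hausdorff_gauge_empty [simp]: "hausdorff_gauge k {} = 0"
  by (simp add: hausdorff_gauge_def)

text \<open>The hypothesis on emptiness matters for \<open>k = 0\<close>, where every
  nonempty set has gauge 1 but the empty set, although its diameter is also 0, has gauge 0.\<close>

lemma hausdorff_gauge_mono_diameter:
  assumes "bounded U" "bounded V" "diameter V \<le> diameter U" "U = {} \<Longrightarrow> V = {}"
  shows "hausdorff_gauge k V \<le> hausdorff_gauge k U"
  using assms diameter_ge_0[of V]
  by (auto simp: hausdorff_gauge_def intro!: ennreal_leI mult_left_mono power_mono)

lemma hausdorff_gauge_mono:
  "bounded U \<Longrightarrow> V \<subseteq> U \<Longrightarrow> hausdorff_gauge k V \<le> hausdorff_gauge k U"
  by (intro hausdorff_gauge_mono_diameter diameter_subset) (auto intro: bounded_subset)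

definition hausdorff_cover :: "real \<Rightarrow> 'a::metric_space set \<Rightarrow> (nat \<Rightarrow> 'a set) \<Rightarrow> bool" where
  "hausdorff_cover \<delta> A U \<longleftrightarrow> A \<subseteq> (\<Union>i. U i) \<and> (\<forall>i. bounded (U i) \<and> diameter (U i) \<le> \<delta>)"

lemma hausdorff_pre_eq_INF:
  "hausdorff_pre k \<delta> A = (INF U\<in>Collect (hausdorff_cover \<delta> A). \<Sum>i. hausdorff_gauge k (U i))"
  unfolding hausdorff_pre_def hausdorff_gauge_def hausdorff_cover_def
  by (rule arg_cong[where f=Inf]) auto

lemma hausdorff_pre_le:
  "hausdorff_cover \<delta> A U \<Longrightarrow> hausdorff_pre k \<delta> A \<le> (\<Sum>i. hausdorff_gauge k (U i))"
  unfolding hausdorff_pre_eq_INF by (rule INF_lower) simp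

lemma hausdorff_pre_mono: "A \<subseteq> B \<Longrightarrow> hausdorff_pre k \<delta> A \<le> hausdorff_pre k \<delta> B"
  unfolding hausdorff_pre_eq_INF
  by (rule INF_superset_mono) (unfold hausdorff_cover_def, blast, simp)

lemma hausdorff_pre_antimono: "\<delta> \<le> \<epsilon> \<Longrightarrow> hausdorff_pre k \<epsilon> A \<le> hausdorff_pre k \<delta> A"
  unfolding hausdorff_pre_eq_INF
  by (rule INF_superset_mono) (unfold hausdorff_cover_def, use order_trans in blast, simp)

lemma hausdorff_pre_empty: "0 \<le> \<delta> \<Longrightarrow> hausdorff_pre k \<delta> {} = 0"
  using hausdorff_pre_le[of \<delta> "{}" "\<lambda>i. {}" k] by (simp add: hausdorff_cover_def)

text \<open>Nearly optimal covers of the sets \<open>A n\<close>, with errors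
  summing to \<open>e\<close>, are merged into one sequence through a pairing of \<open>\<nat> \<times> \<nat>\<close> with \<open>\<nat>\<close>.\<close>

lemma hausdorff_pre_countably_subadditive:
  fixes A :: "nat \<Rightarrow> 'a::metric_space set"
  shows "hausdorff_pre k \<delta> (\<Union>i. A i) \<le> (\<Sum>i. hausdorff_pre k \<delta> (A i))"
proof (rule ennreal_le_epsilon)
  fix e :: real
  assume fin: "(\<Sum>i. hausdorff_pre k \<delta> (A i)) < top" and "0 < e"
  have "\<exists>U. hausdorff_cover \<delta> (A n) U \<and>
      (\<Sum>i. hausdorff_gauge k (U i)) \<le> hausdorff_pre k \<delta> (A n) + ennreal (e * (1/2) ^ Suc n)" for n
  proof -
    have "hausdorff_pre k \<delta> (A n) < top"
      using fin by (metis ennreal_suminf_lessD)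
    then have "hausdorff_pre k \<delta> (A n) < hausdorff_pre k \<delta> (A n) + ennreal (e * (1/2) ^ Suc n)"
      using \<open>0 < e\<close>
      by (cases "hausdorff_pre k \<delta> (A n)" rule: ennreal_cases)
         (auto simp flip: ennreal_plus simp: ennreal_less_iff)
    then show ?thesis
      unfolding hausdorff_pre_eq_INF[of k \<delta> "A n"] INF_less_iff by (auto intro: less_imp_le)
  qed
  then obtain U where U: "\<And>n. hausdorff_cover \<delta> (A n) (U n)"
    "\<And>n. (\<Sum>i. hausdorff_gauge k (U n i)) \<le> hausdorff_pre k \<delta> (A n) + ennreal (e * (1/2) ^ Suc n)"
    by metis
  define W where "W = (\<lambda>i. case prod_decode i of (n, j) \<Rightarrow> U n j)"
  have "hausdorff_cover \<delta> (\<Union>i. A i) W"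
    unfolding hausdorff_cover_def
  proof (intro conjI allI subsetI)
    fix x assume "x \<in> (\<Union>i. A i)"
    then obtain n where "x \<in> A n" by auto
    then obtain j where "x \<in> U n j" using U(1)[of n] unfolding hausdorff_cover_def by auto
    then show "x \<in> (\<Union>i. W i)"
      by (auto simp: W_def intro!: exI[of _ "prod_encode (n, j)"])
  next
    fix i show "bounded (W i)" "diameter (W i) \<le> \<delta>"
      using U(1) unfolding hausdorff_cover_def W_def by (auto split: prod.split)
  qed
  then have "hausdorff_pre k \<delta> (\<Union>i. A i) \<le> (\<Sum>i. hausdorff_gauge k (W i))"
    by (rule hausdorff_pre_le)
  also have "\<dots> = (\<Sum>n. \<Sum>j. hausdorff_gauge k (U n j))"
  proof -
    have "(\<lambda>i. hausdorff_gauge k (W i)) =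
        (\<lambda>p. hausdorff_gauge k (U (fst p) (snd p))) \<circ> prod_decode"
      by (auto simp: W_def split: prod.split)
    then show ?thesis
      using suminf_ennreal_2dimen[of "\<lambda>n. \<Sum>j. hausdorff_gauge k (U n j)"
          "\<lambda>p. hausdorff_gauge k (U (fst p) (snd p))"]
      by (simp add: o_def)
  qed
  also have "\<dots> \<le> (\<Sum>n. hausdorff_pre k \<delta> (A n) + ennreal (e * (1/2) ^ Suc n))"
    using U(2) by (intro suminf_le) auto
  also have "\<dots> = (\<Sum>n. hausdorff_pre k \<delta> (A n)) + (\<Sum>n. ennreal (e * (1/2) ^ Suc n))"
    by (rule suminf_add[symmetric]) auto
  also have "(\<Sum>n. ennreal (e * (1/2) ^ Suc n)) = ennreal e"
    using \<open>0 < e\<close> sums_mult[OF power_half_series, of e]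
    by (intro suminf_ennreal_eq) auto
  finally show "hausdorff_pre k \<delta> (\<Union>i. A i) \<le> (\<Sum>i. hausdorff_pre k \<delta> (A i)) + ennreal e" .
qed

lemma hausdorff_pre_le_outer: "0 < \<delta> \<Longrightarrow> hausdorff_pre k \<delta> A \<le> hausdorff_outer k A"
  unfolding hausdorff_outer_def by (rule SUP_upper) simp

lemma hausdorff_outer_mono: "A \<subseteq> B \<Longrightarrow> hausdorff_outer k A \<le> hausdorff_outer k B"
  unfolding hausdorff_outer_def by (intro SUP_mono') (rule hausdorff_pre_mono)

lemma hausdorff_outer_empty [simp]: "hausdorff_outer k {} = 0"
  unfolding hausdorff_outer_def by (simp add: hausdorff_pre_empty)

lemma hausdorff_outer_countably_subadditive:
  fixes A :: "nat \<Rightarrow> 'a::metric_space set"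
  shows "hausdorff_outer k (\<Union>i. A i) \<le> (\<Sum>i. hausdorff_outer k (A i))"
  unfolding hausdorff_outer_def[of k "\<Union>i. A i"]
proof (rule SUP_least)
  fix \<delta> :: real assume "\<delta> \<in> {0<..}"
  then show "hausdorff_pre k \<delta> (\<Union>i. A i) \<le> (\<Sum>i. hausdorff_outer k (A i))"
    by (intro order_trans[OF hausdorff_pre_countably_subadditive] suminf_le hausdorff_pre_le_outer)
       auto
qed

lemma outer_measure_space_hausdorff_outer:
  "outer_measure_space UNIV (hausdorff_outer k :: 'a::metric_space set \<Rightarrow> ennreal)"
  unfolding outer_measure_space_def positive_def increasing_def countably_subadditive_def
  using hausdorff_outer_countably_subadditive hausdorff_outer_mono by auto

lemma hausdorff_outer_Un_le:
  "hausdorff_outer k (A \<union> B) \<le> hausdorff_outer k A + hausdorff_outer k B"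
proof -
  define C where "C = (\<lambda>i::nat. if i = 0 then A else if i = 1 then B else {})"
  have "(\<Sum>i. hausdorff_outer k (C i)) = (\<Sum>i<2. hausdorff_outer k (C i))"
    by (rule suminf_finite) (simp_all add: C_def)
  also have "\<dots> = hausdorff_outer k A + hausdorff_outer k B"
    by (simp add: C_def numeral_2_eq_2)
  finally have "(\<Sum>i. hausdorff_outer k (C i)) = hausdorff_outer k A + hausdorff_outer k B" .
  moreover have "A \<union> B \<subseteq> (\<Union>i. C i)"
    using UN_upper[of 0 UNIV C] UN_upper[of 1 UNIV C] by (simp add: C_def)
  ultimately show ?thesis
    by (metis hausdorff_outer_countably_subadditive hausdorff_outer_mono order_trans)
qed

text \<open>A cover of \<open>A\<close>, cut down to \<open>A\<close>, is carried by \<open>f\<close> to a cover of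
  the image with no larger diameters. Cutting down is essential, because \<open>f\<close> is controlled on \<open>A\<close>
  only.\<close>

lemma hausdorff_pre_lipschitz_image_le:
  fixes f :: "'a::metric_space \<Rightarrow> 'b::metric_space"
  assumes f: "\<And>x y. x \<in> A \<Longrightarrow> y \<in> A \<Longrightarrow> dist (f x) (f y) \<le> dist x y" and "0 \<le> \<delta>"
  shows "hausdorff_pre k \<delta> (f ` A) \<le> hausdorff_pre k \<delta> A"
  unfolding hausdorff_pre_eq_INF[of k \<delta> A]
proof (rule INF_greatest)
  fix U assume "U \<in> Collect (hausdorff_cover \<delta> A)"
  then have U: "A \<subseteq> (\<Union>i. U i)" "\<And>i. bounded (U i)" "\<And>i. diameter (U i) \<le> \<delta>"
    by (auto simp: hausdorff_cover_def)
  define V where "V = (\<lambda>i. f ` (U i \<inter> A))"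
  have dst: "dist a b \<le> diameter (U i)" if "a \<in> V i" "b \<in> V i" for i a b
    using that f diameter_bounded_bound[OF U(2)[of i]]
    by (fastforce simp: V_def intro: order_trans[OF f])
  have bV: "bounded (V i)" for i
    using dst unfolding bounded_def by (cases "V i = {}") blast+
  have dV: "diameter (V i) \<le> diameter (U i)" for i
  proof (cases "V i = {}")
    case True then show ?thesis using diameter_ge_0[OF U(2)] by simp
  next
    case False
    then show ?thesis unfolding diameter_def[of "V i"] using dst by (simp, intro cSUP_least) auto
  qed
  have "hausdorff_cover \<delta> (f ` A) V"
    unfolding hausdorff_cover_def using U bV dV by (fastforce simp: V_def intro: order_trans)
  then have "hausdorff_pre k \<delta> (f ` A) \<le> (\<Sum>i. hausdorff_gauge k (V i))"
    by (rule hausdorff_pre_le)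
  also have "\<dots> \<le> (\<Sum>i. hausdorff_gauge k (U i))"
    using U bV dV by (intro suminf_le hausdorff_gauge_mono_diameter) (auto simp: V_def)
  finally show "hausdorff_pre k \<delta> (f ` A) \<le> (\<Sum>i. hausdorff_gauge k (U i))" .
qed

lemma hausdorff_outer_lipschitz_image_le:
  fixes f :: "'a::metric_space \<Rightarrow> 'b::metric_space"
  assumes "\<And>x y. x \<in> A \<Longrightarrow> y \<in> A \<Longrightarrow> dist (f x) (f y) \<le> dist x y"
  shows "hausdorff_outer k (f ` A) \<le> hausdorff_outer k A"
  unfolding hausdorff_outer_def
  using assms by (intro SUP_subset_mono hausdorff_pre_lipschitz_image_le) auto

text \<open>The two spaces may differ. This is what allows a flat
  simplex of \<open>\<real>\<^sup>d\<close> to be measured inside \<open>\<real>\<^sup>k\<close>.\<close>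

lemma hausdorff_outer_isometric_image:
  fixes f :: "'a::metric_space \<Rightarrow> 'b::metric_space"
  assumes f: "\<And>x y. x \<in> A \<Longrightarrow> y \<in> A \<Longrightarrow> dist (f x) (f y) = dist x y"
  shows "hausdorff_outer k (f ` A) = hausdorff_outer k A"
proof (rule antisym)
  have inj: "inj_on f A"
    by (rule inj_onI) (metis f dist_eq_0_iff)
  have "A = the_inv_into A f ` (f ` A)"
    using inj by (force simp: the_inv_into_f_f image_image)
  then have "hausdorff_outer k A = hausdorff_outer k (the_inv_into A f ` (f ` A))"
    by simp
  also have "\<dots> \<le> hausdorff_outer k (f ` A)"
    by (rule hausdorff_outer_lipschitz_image_le) (auto simp: the_inv_into_f_f[OF inj] f)
  finally show "hausdorff_outer k A \<le> hausdorff_outer k (f ` A)" .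
qed (auto intro!: hausdorff_outer_lipschitz_image_le simp: f)

text \<open>A set of diameter less than \<open>\<epsilon>\<close> cannot meet both \<open>A\<close> and \<open>B\<close>, so
  a fine cover of the union splits into a cover of \<open>A\<close> and a cover of \<open>B\<close>.\<close>

lemma hausdorff_outer_separated:
  assumes "0 < \<epsilon>" and sep: "\<And>x y. x \<in> A \<Longrightarrow> y \<in> B \<Longrightarrow> \<epsilon> \<le> dist x y"
  shows "hausdorff_outer k A + hausdorff_outer k B \<le> hausdorff_outer k (A \<union> B)"
proof -
  have pre: "hausdorff_pre k \<delta> A + hausdorff_pre k \<delta> B \<le> hausdorff_pre k \<delta> (A \<union> B)"
    if "0 < \<delta>" "\<delta> < \<epsilon>" for \<delta>
    unfolding hausdorff_pre_eq_INF[of k \<delta> "A \<union> B"]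
  proof (rule INF_greatest)
    fix U assume "U \<in> Collect (hausdorff_cover \<delta> (A \<union> B))"
    then have U: "A \<union> B \<subseteq> (\<Union>i. U i)" "\<And>i. bounded (U i)" "\<And>i. diameter (U i) \<le> \<delta>"
      by (auto simp: hausdorff_cover_def)
    have disj: "U i \<inter> A = {} \<or> U i \<inter> B = {}" for i
    proof (rule ccontr)
      assume "\<not> ?thesis"
      then obtain x y where "x \<in> U i" "x \<in> A" "y \<in> U i" "y \<in> B" by auto
      then show False
        using sep[of x y] diameter_bounded_bound[OF U(2)[of i], of x y] U(3)[of i] that by simp
    qed
    have cov: "hausdorff_cover \<delta> C (\<lambda>i. U i \<inter> C)" if "C \<subseteq> A \<union> B" for C
      using that U diameter_subset[OF Int_lower1 U(2)]
      unfolding hausdorff_cover_def by (fastforce intro: bounded_subset order_trans)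
    have "hausdorff_pre k \<delta> A + hausdorff_pre k \<delta> B \<le>
        (\<Sum>i. hausdorff_gauge k (U i \<inter> A)) + (\<Sum>i. hausdorff_gauge k (U i \<inter> B))"
      by (intro add_mono hausdorff_pre_le cov) auto
    also have "\<dots> = (\<Sum>i. hausdorff_gauge k (U i \<inter> A) + hausdorff_gauge k (U i \<inter> B))"
      by (rule suminf_add) auto
    also have "\<dots> \<le> (\<Sum>i. hausdorff_gauge k (U i))"
    proof (intro suminf_le)
      fix i show "hausdorff_gauge k (U i \<inter> A) + hausdorff_gauge k (U i \<inter> B) \<le> hausdorff_gauge k (U i)"
        using disj[of i] hausdorff_gauge_mono[OF U(2)[of i], of "U i \<inter> A" k]
          hausdorff_gauge_mono[OF U(2)[of i], of "U i \<inter> B" k] by auto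
    qed auto
    finally show "hausdorff_pre k \<delta> A + hausdorff_pre k \<delta> B \<le> (\<Sum>i. hausdorff_gauge k (U i))" .
  qed
  have "hausdorff_outer k A + hausdorff_outer k B =
      (SUP \<delta>\<in>{0<..}. hausdorff_pre k \<delta> A + hausdorff_pre k \<delta> B)"
    unfolding hausdorff_outer_def
  proof (rule SUP_add_directed_ennreal[symmetric])
    fix \<delta> \<delta>' :: real assume "\<delta> \<in> {0<..}" "\<delta>' \<in> {0<..}"
    then show "\<exists>\<gamma>\<in>{0<..}. hausdorff_pre k \<delta> A + hausdorff_pre k \<delta>' B \<le>
        hausdorff_pre k \<gamma> A + hausdorff_pre k \<gamma> B"
      by (intro bexI[of _ "min \<delta> \<delta>'"] add_mono hausdorff_pre_antimono) auto
  qed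
  also have "\<dots> \<le> hausdorff_outer k (A \<union> B)"
  proof (rule SUP_least)
    fix \<delta> :: real assume "\<delta> \<in> {0<..}"
    define \<gamma> where "\<gamma> = min \<delta> (\<epsilon> / 2)"
    have "0 < \<gamma>" "\<gamma> \<le> \<delta>" "\<gamma> < \<epsilon>"
      using \<open>\<delta> \<in> {0<..}\<close> \<open>0 < \<epsilon>\<close> by (auto simp: \<gamma>_def)
    have "hausdorff_pre k \<delta> A + hausdorff_pre k \<delta> B \<le> hausdorff_pre k \<gamma> A + hausdorff_pre k \<gamma> B"
      using \<open>\<gamma> \<le> \<delta>\<close> by (intro add_mono hausdorff_pre_antimono)
    also have "\<dots> \<le> hausdorff_pre k \<gamma> (A \<union> B)"
      using \<open>0 < \<gamma>\<close> \<open>\<gamma> < \<epsilon>\<close> by (rule pre)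
    also have "\<dots> \<le> hausdorff_outer k (A \<union> B)"
      using \<open>0 < \<gamma>\<close> by (rule hausdorff_pre_le_outer)
    finally show "hausdorff_pre k \<delta> A + hausdorff_pre k \<delta> B \<le> hausdorff_outer k (A \<union> B)" .
  qed
  finally show ?thesis .
qed

text \<open>Continuity from below along a sequence in which each member is at
  positive distance from everything outside the next one. The layers \<open>R i = E (Suc i) - E i\<close> with
  indices of equal parity are separated from each other, so both the even and the odd layers have total measure at most
  the supremum. Hence, when the supremum is finite, the measures of the layers form a convergent series,
  whose tails bound what \<open>E n\<close> misses.\<close>

lemma hausdorff_outer_UN_le_SUP:
  fixes E :: "nat \<Rightarrow> 'a::metric_space set"
  assumes mono: "\<And>m. E m \<subseteq> E (Suc m)"
    and sep: "\<And>m. \<exists>\<epsilon>>0. \<forall>x\<in>E m. \<forall>y\<in>(\<Union>i. E i) - E (Suc m). \<epsilon> \<le> dist x y"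
  shows "hausdorff_outer k (\<Union>i. E i) \<le> (SUP i. hausdorff_outer k (E i))"
proof (cases "(SUP i. hausdorff_outer k (E i)) = top")
  case False
  define S where "S = (SUP i. hausdorff_outer k (E i))"
  have S: "hausdorff_outer k (E i) \<le> S" for i
    unfolding S_def by (rule SUP_upper) simp
  have "S \<noteq> top" using False by (simp add: S_def)
  have inc: "E i \<subseteq> E j" if "i \<le> j" for i j
    using lift_Suc_mono_le[of E, OF mono that] .
  define R where "R = (\<lambda>i. E (Suc i) - E i)"
  have RS: "R i \<subseteq> E j" if "i < j" for i j
    using inc[of "Suc i" j] that by (auto simp: R_def)
  have alternate: "(\<Sum>j<n. hausdorff_outer k (R (2 * j + p))) \<le>
      hausdorff_outer k (\<Union>j<n. R (2 * j + p))" for n p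
  proof (induction n)
    case (Suc n)
    let ?V = "\<Union>j<n. R (2 * j + p)"
    show ?case
    proof (cases n)
      case (Suc n')
      \<comment> \<open>the first \<open>n\<close> layers of this parity lie in \<open>E (2 * n + p - 1)\<close>, the new one outside \<open>E (2 * n + p)\<close>\<close>
      obtain \<epsilon> where "\<epsilon> > 0"
        and \<epsilon>: "\<And>x y. x \<in> E (2*n + p - 1) \<Longrightarrow> y \<in> (\<Union>i. E i) - E (2*n + p) \<Longrightarrow> \<epsilon> \<le> dist x y"
        using sep[of "2 * n + p - 1"] Suc by auto
      have V: "?V \<subseteq> E (2*n + p - 1)"
        using Suc by (intro UN_least RS) auto
      have "(\<Sum>j<Suc n. hausdorff_outer k (R (2 * j + p))) \<le>
          hausdorff_outer k ?V + hausdorff_outer k (R (2 * n + p))"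
        using add_right_mono[OF Suc.IH, of "hausdorff_outer k (R (2 * n + p))"]
        by (simp only: sum.lessThan_Suc)
      also have "\<dots> \<le> hausdorff_outer k (?V \<union> R (2 * n + p))"
        by (rule hausdorff_outer_separated[OF \<open>\<epsilon> > 0\<close> \<epsilon>]) (use V in \<open>auto simp: R_def\<close>)
      also have "?V \<union> R (2 * n + p) = (\<Union>j<Suc n. R (2 * j + p))"
        by (simp only: lessThan_Suc UN_insert Un_commute)
      finally show ?thesis .
    qed (simp add: lessThan_Suc)
  qed simp
  have alternate_le: "(\<Sum>j<n. hausdorff_outer k (R (2 * j + p))) \<le> S" for n p
  proof -
    have "(\<Union>j<n. R (2 * j + p)) \<subseteq> E (2 * n + p)"
      by (intro UN_least RS) auto
    then show ?thesis
      by (intro order_trans[OF alternate order_trans[OF hausdorff_outer_mono S]])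
  qed
  have "(\<Sum>j<n. hausdorff_outer k (R j)) \<le> S + S" for n
  proof -
    have "(\<Sum>j<n. hausdorff_outer k (R j)) \<le> (\<Sum>j<2*n. hausdorff_outer k (R j))"
      by (rule sum_mono2) auto
    also have "\<dots> = (\<Sum>j<n. hausdorff_outer k (R (2 * j + 0))) + (\<Sum>j<n. hausdorff_outer k (R (2 * j + 1)))"
      by (induction n) (auto simp: algebra_simps)
    also have "\<dots> \<le> S + S"
      by (intro add_mono alternate_le)
    finally show ?thesis .
  qed
  then have "(\<Sum>j. hausdorff_outer k (R j)) \<le> S + S"
    by (simp add: suminf_eq_SUP SUP_le_iff)
  then have Rfin: "(\<Sum>j. hausdorff_outer k (R j)) \<noteq> top"
    using \<open>S \<noteq> top\<close> by (auto simp: top_unique)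
  define r where "r = (\<lambda>j. enn2real (hausdorff_outer k (R j)))"
  have r: "hausdorff_outer k (R j) = ennreal (r j)" "0 \<le> r j" for j
    using Rfin S[of "Suc j"] RS[of j "Suc j"] ennreal_suminf_lessD[of "\<lambda>j. hausdorff_outer k (R j)" top j]
    by (auto simp: r_def ennreal_enn2real_if less_top)
  have "summable r"
    using Rfin r by (intro summable_suminf_not_top) auto
  have "hausdorff_outer k (\<Union>i. E i) \<le> S"
  proof (rule ennreal_le_epsilon)
    fix e :: real assume "0 < e"
    obtain n where n: "norm (\<Sum>i. r (i + n)) < e"
      using suminf_exist_split[OF \<open>0 < e\<close> \<open>summable r\<close>] by blast
    have cover: "x \<in> E n \<union> (\<Union>i. R (i + n))" if "x \<in> E m" for x m
    proof (cases "x \<in> E n")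
      case False
      then have "\<exists>j. x \<notin> E (j + n) \<and> x \<in> E (Suc j + n)"
      proof -
        define l where "l = (LEAST l. x \<in> E l)"
        have l: "x \<in> E l" unfolding l_def using that by (rule LeastI)
        have "n < l" using l False inc[of l n] by (meson not_le subsetD)
        then have "x \<notin> E (l - 1)" unfolding l_def by (intro not_less_Least) auto
        then show ?thesis using \<open>n < l\<close> l by (intro exI[of _ "l - 1 - n"]) auto
      qed
      then show ?thesis by (auto simp: R_def)
    qed simp
    have "hausdorff_outer k (\<Union>i. E i) \<le> hausdorff_outer k (E n \<union> (\<Union>i. R (i + n)))"
      using cover by (intro hausdorff_outer_mono) blast
    also have "\<dots> \<le> hausdorff_outer k (E n) + (\<Sum>i. hausdorff_outer k (R (i + n)))"
      by (intro order_trans[OF hausdorff_outer_Un_le] add_left_mono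
          hausdorff_outer_countably_subadditive)
    also have "(\<Sum>i. hausdorff_outer k (R (i + n))) = ennreal (\<Sum>i. r (i + n))"
      unfolding r(1) using r(2) \<open>summable r\<close> by (intro suminf_ennreal2) (auto simp: summable_iff_shift)
    also have "hausdorff_outer k (E n) + ennreal (\<Sum>i. r (i + n)) \<le> S + ennreal e"
      using n S by (intro add_mono ennreal_leI) auto
    finally show "hausdorff_outer k (\<Union>i. E i) \<le> S + ennreal e" .
  qed
  then show ?thesis by (simp add: S_def)
qed (simp only: top_greatest)

text \<open>The criterion of Caratheodory for closed sets. The part of \<open>A\<close>
  outside \<open>F\<close> is exhausted by its points at distance at least \<open>1 / (m + 1)\<close> from \<open>F\<close>, and these are
  separated from \<open>A \<inter> F\<close>.\<close>

lemma hausdorff_outer_closed_split: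
  fixes F :: "'a::metric_space set"
  assumes "closed F"
  shows "hausdorff_outer k (A \<inter> F) + hausdorff_outer k (A - F) \<le> hausdorff_outer k A"
proof (cases "F = {}")
  case False
  define E where "E = (\<lambda>m. {x\<in>A. 1 / real (Suc m) \<le> infdist x F})"
  have UN_E: "(\<Union>m. E m) = A - F"
  proof (intro equalityI subsetI)
    fix x assume x: "x \<in> A - F"
    then have "0 < infdist x F"
      using infdist_pos_not_in_closed[OF assms False, of x] by auto
    then obtain m where "inverse (real (Suc m)) < infdist x F"
      using reals_Archimedean by blast
    then show "x \<in> (\<Union>m. E m)" using x by (auto simp: E_def inverse_eq_divide intro!: exI[of _ m])
  next
    fix x assume "x \<in> (\<Union>m. E m)"
    then obtain m where "x \<in> A" "1 / real (Suc m) \<le> infdist x F" by (auto simp: E_def)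
    moreover from this(2) have "0 < infdist x F" by (rule less_le_trans[rotated]) simp
    ultimately show "x \<in> A - F" by auto
  qed
  have "hausdorff_outer k (A - F) \<le> (SUP m. hausdorff_outer k (E m))"
    unfolding UN_E[symmetric]
  proof (rule hausdorff_outer_UN_le_SUP)
    fix m
    show "E m \<subseteq> E (Suc m)"
    proof -
      have "1 / real (Suc (Suc m)) \<le> 1 / real (Suc m)"
        by (simp add: frac_le)
      then show ?thesis
        unfolding E_def by (auto intro: order_trans)
    qed
    have "1 / real (Suc m) - 1 / real (Suc (Suc m)) \<le> dist x y"
      if "x \<in> E m" "y \<in> (\<Union>i. E i) - E (Suc m)" for x y
      using that infdist_triangle[of x F y] by (auto simp: E_def)
    moreover have "0 < 1 / real (Suc m) - 1 / real (Suc (Suc m))"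
      by (simp add: frac_less2)
    ultimately show "\<exists>\<epsilon>>0. \<forall>x\<in>E m. \<forall>y\<in>(\<Union>i. E i) - E (Suc m). \<epsilon> \<le> dist x y"
      by blast
  qed
  then have "hausdorff_outer k (A \<inter> F) + hausdorff_outer k (A - F) \<le>
      hausdorff_outer k (A \<inter> F) + (SUP m. hausdorff_outer k (E m))"
    by (rule add_left_mono)
  also have "\<dots> = (SUP m. hausdorff_outer k (A \<inter> F) + hausdorff_outer k (E m))"
    by (simp add: ennreal_SUP_add_right)
  also have "\<dots> \<le> hausdorff_outer k A"
  proof (rule SUP_least)
    fix m
    have "hausdorff_outer k (A \<inter> F) + hausdorff_outer k (E m) \<le> hausdorff_outer k ((A \<inter> F) \<union> E m)"
    proof (rule hausdorff_outer_separated)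
      fix x y assume "x \<in> A \<inter> F" "y \<in> E m"
      then show "1 / real (Suc m) \<le> dist x y"
        using infdist_le[of x F y] by (auto simp: E_def dist_commute)
    qed simp
    also have "\<dots> \<le> hausdorff_outer k A"
      by (rule hausdorff_outer_mono) (auto simp: E_def)
    finally show "hausdorff_outer k (A \<inter> F) + hausdorff_outer k (E m) \<le> hausdorff_outer k A" .
  qed
  finally show ?thesis .
qed simp

text \<open>Consequently the measure of a Borel set under
  \<^const>\<open>hausdorff_measure\<close> really is its outer measure, and not the value 0 that
  \<^const>\<open>measure_of\<close> assigns when countable additivity fails.\<close>

lemma measure_space_hausdorff_outer:
  "measure_space UNIV (sets borel) (hausdorff_outer k :: 'a::metric_space set \<Rightarrow> ennreal)"
proof -
  let ?H = "hausdorff_outer k :: 'a set \<Rightarrow> ennreal"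
  interpret sigma_algebra UNIV "UNIV :: 'a set set"
    using sigma_algebra_Pow[of "UNIV :: 'a set"] by simp
  have ms: "measure_space UNIV (lambda_system UNIV UNIV ?H) ?H"
    by (rule caratheodory_lemma[OF outer_measure_space_hausdorff_outer])
  have "{F :: 'a set. closed F} \<subseteq> lambda_system UNIV UNIV ?H"
  proof (clarsimp simp: lambda_system_eq)
    fix F A :: "'a set" assume "closed F"
    have "?H A \<le> ?H (A \<inter> F) + ?H (A - F)"
      using hausdorff_outer_Un_le[of k "A \<inter> F" "A - F"] by (simp add: Int_Diff_Un)
    then show "?H (A \<inter> F) + ?H (A - F) = ?H A"
      using hausdorff_outer_closed_split[OF \<open>closed F\<close>, of k A] by (rule antisym[rotated])
  qed
  then have "sigma_sets UNIV {F :: 'a set. closed F} \<subseteq> lambda_system UNIV UNIV ?H"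
    using sigma_algebra.sigma_sets_subset ms unfolding measure_space_def by blast
  moreover have "sets borel = sigma_sets UNIV {F :: 'a set. closed F}"
    by (simp add: borel_eq_closed)
  ultimately show ?thesis
    using measure_down[OF ms, of "sets borel"] sets.sigma_algebra_axioms[of "borel :: 'a measure"]
    by simp
qed

lemma space_hausdorff_measure [simp]: "space (hausdorff_measure k) = UNIV"
  by (simp add: hausdorff_measure_def space_measure_of_conv)

lemma sets_hausdorff_measure [simp, measurable_cong]: "sets (hausdorff_measure k) = sets borel"
  using sets.sigma_sets_eq[of borel] by (simp add: hausdorff_measure_def sets_measure_of_conv)

lemma emeasure_hausdorff_measure:
  "A \<in> sets borel \<Longrightarrow> emeasure (hausdorff_measure k) A = hausdorff_outer k A"
  using measure_space_hausdorff_outer[of k]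
  unfolding hausdorff_measure_def measure_space_def
  by (intro emeasure_measure_of_sigma) auto

section \<open>Hausdorff measure of full dimension and linear maps\<close>

text \<open>With \<open>B\<close> the unit cube and \<open>\<lambda>\<close> the Lebesgue
  measure, the integral of \<open>indicator B y * indicator A (x + y)\<close> against \<open>M(dx) \<lambda>(dy)\<close> is \<open>M A * \<lambda> B\<close>
  by the invariance of \<open>M\<close>. After the substitution \<open>z = x + y\<close>, which is justified by the invariance of
  \<open>\<lambda>\<close>, it is \<open>M (- B) * \<lambda> A\<close>. So the factor is \<open>\<kappa> = M (- B)\<close>, as \<open>\<lambda> B = 1\<close>.\<close>

lemma translation_invariant_measure_eq_scaled_lborel:
  fixes M :: "'a::euclidean_space measure"
  assumes sets_M [measurable_cong]: "sets M = sets borel"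
    and fin: "sigma_finite_measure M"
    and trans: "\<And>a A. A \<in> sets borel \<Longrightarrow> emeasure M ((+) a ` A) = emeasure M A"
  shows "\<exists>\<kappa>. \<forall>A\<in>sets borel. emeasure M A = \<kappa> * emeasure lborel A"
proof (intro exI ballI)
  define B :: "'a set" where "B = cbox 0 One"
  have [measurable]: "B \<in> sets borel" by (simp add: B_def)
  have lB: "emeasure lborel B = 1"
    by (simp add: B_def)
  interpret M: sigma_finite_measure M by (rule fin)
  interpret pair_sigma_finite M "lborel :: 'a measure"
    by unfold_locales
  fix A :: "'a set" assume [measurable]: "A \<in> sets borel"
  have MA: "emeasure M {x. x + y \<in> A} = emeasure M A" for y
  proof -
    have "{x. x + y \<in> A} = (+) (- y) ` A"
      by (auto simp: image_iff algebra_simps intro!: bexI[of _ "_ + y"])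
    then show ?thesis using trans[OF \<open>A \<in> sets borel\<close>] by (simp only:)
  qed
  have MB: "emeasure M {x. z - x \<in> B} = emeasure M {x. - x \<in> B}" for z
  proof -
    have "{x. z - x \<in> B} = (+) z ` {x. - x \<in> B}"
      by (auto simp: image_iff intro!: exI[of _ "_ - z"])
    moreover have "{x. - x \<in> B} \<in> sets borel" by measurable
    ultimately show ?thesis using trans by simp
  qed
  have "emeasure M A = (\<integral>\<^sup>+y. indicator B y * emeasure M A \<partial>lborel)"
    by (simp add: nn_integral_multc lB)
  also have "\<dots> = (\<integral>\<^sup>+y. \<integral>\<^sup>+x. indicator B y * indicator A (x + y) \<partial>M \<partial>lborel)"
  proof (rule nn_integral_cong)
    fix y :: 'a
    have "(\<integral>\<^sup>+x. indicator B y * indicator A (x + y) \<partial>M) =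
        indicator B y * (\<integral>\<^sup>+x. indicator {x. x + y \<in> A} x \<partial>M)"
      by (subst nn_integral_cmult[symmetric]) (auto intro!: nn_integral_cong simp: indicator_def)
    also have "\<dots> = indicator B y * emeasure M A"
      by (subst nn_integral_indicator) (auto simp: MA)
    finally show "indicator B y * emeasure M A =
        (\<integral>\<^sup>+x. indicator B y * indicator A (x + y) \<partial>M)" ..
  qed
  also have "\<dots> = (\<integral>\<^sup>+x. \<integral>\<^sup>+y. indicator B y * indicator A (x + y) \<partial>lborel \<partial>M)"
    by (rule Fubini') measurable
  also have "\<dots> = (\<integral>\<^sup>+x. \<integral>\<^sup>+z. indicator B (z - x) * indicator A z \<partial>lborel \<partial>M)"
  proof (rule nn_integral_cong)
    fix x :: 'a
    have "(\<integral>\<^sup>+z. indicator B (z - x) * indicator A z \<partial>lborel) =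
        (\<integral>\<^sup>+z. indicator B (z - x) * indicator A z \<partial>distr lborel borel ((+) x))"
      by (simp add: lborel_distr_plus)
    also have "\<dots> = (\<integral>\<^sup>+y. indicator B y * indicator A (x + y) \<partial>lborel)"
      by (subst nn_integral_distr) auto
    finally show "(\<integral>\<^sup>+y. indicator B y * indicator A (x + y) \<partial>lborel) =
        (\<integral>\<^sup>+z. indicator B (z - x) * indicator A z \<partial>lborel)" ..
  qed
  also have "\<dots> = (\<integral>\<^sup>+z. \<integral>\<^sup>+x. indicator B (z - x) * indicator A z \<partial>M \<partial>lborel)"
    by (rule Fubini'[symmetric]) measurable
  also have "\<dots> = (\<integral>\<^sup>+z. emeasure M {x. - x \<in> B} * indicator A z \<partial>lborel)"
  proof (rule nn_integral_cong)
    fix z :: 'a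
    have "(\<integral>\<^sup>+x. indicator B (z - x) * indicator A z \<partial>M) =
        (\<integral>\<^sup>+x. indicator {x. z - x \<in> B} x \<partial>M) * indicator A z"
      by (subst nn_integral_multc[symmetric]) (auto intro!: nn_integral_cong simp: indicator_def)
    also have "\<dots> = emeasure M {x. - x \<in> B} * indicator A z"
      by (subst nn_integral_indicator) (auto simp: MB)
    finally show "(\<integral>\<^sup>+x. indicator B (z - x) * indicator A z \<partial>M) =
        emeasure M {x. - x \<in> B} * indicator A z" .
  qed
  also have "\<dots> = emeasure M {x. - x \<in> B} * emeasure lborel A"
    by (simp add: nn_integral_cmult)
  finally show "emeasure M A = emeasure M {x. - x \<in> B} * emeasure lborel A" .
qed

lemma hausdorff_pre_le_finite_cover:
  assumes "finite I" "A \<subseteq> (\<Union>p\<in>I. Q p)" "0 \<le> \<delta>"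
    and Q: "\<And>p. p \<in> I \<Longrightarrow> bounded (Q p)" "\<And>p. p \<in> I \<Longrightarrow> diameter (Q p) \<le> \<delta>"
  shows "hausdorff_pre k \<delta> A \<le> (\<Sum>p\<in>I. hausdorff_gauge k (Q p))"
proof -
  obtain h where h: "bij_betw h {..<card I} I"
    using ex_bij_betw_nat_finite[OF \<open>finite I\<close>] by (auto simp: atLeast0LessThan)
  define U where "U = (\<lambda>i. if i < card I then Q (h i) else {})"
  have hI: "h i \<in> I" if "i < card I" for i
    using h that by (auto simp: bij_betw_def)
  have "\<exists>i<card I. p = h i" if "p \<in> I" for p
    using that h by (metis bij_betw_imp_surj_on imageE lessThan_iff)
  then have "(\<Union>p\<in>I. Q p) = (\<Union>i<card I. Q (h i))"
    using hI by blast
  also have "\<dots> \<subseteq> (\<Union>i. U i)"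
    by (auto simp: U_def)
  finally have "hausdorff_cover \<delta> A U"
    using assms(2,3) Q hI by (auto simp: hausdorff_cover_def U_def)
  then have "hausdorff_pre k \<delta> A \<le> (\<Sum>i. hausdorff_gauge k (U i))"
    by (rule hausdorff_pre_le)
  also have "\<dots> = (\<Sum>i<card I. hausdorff_gauge k (U i))"
    by (rule suminf_finite) (auto simp: U_def)
  also have "\<dots> = (\<Sum>i<card I. hausdorff_gauge k (Q (h i)))"
    by (rule sum.cong) (auto simp: U_def)
  also have "\<dots> = (\<Sum>p\<in>I. hausdorff_gauge k (Q p))"
    by (rule sum.reindex_bij_betw[OF h])
  finally show ?thesis .
qed

text \<open>The grid of mesh \<open>1 / N\<close> covers the cube by at most
  \<open>(2 N) ^ k\<close> cubes of diameter \<open>sqrt k / N\<close>, whose gauges add up to a bound free of \<open>N\<close>.\<close>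

lemma hausdorff_outer_unit_cube_finite:
  "hausdorff_outer CARD('k) (cbox 0 1 :: (real^'k) set) < top"
proof -
  let ?k = "CARD('k)"
  let ?s = "sqrt (real ?k)"
  define C where "C = unit_ball_vol (real ?k) * ?s ^ ?k"
  have "hausdorff_pre ?k \<delta> (cbox 0 1 :: (real^'k) set) \<le> ennreal C" if "0 < \<delta>" for \<delta>
  proof -
    obtain N :: nat where N: "?s / \<delta> < real N"
      using reals_Archimedean2 by blast
    then have "0 < real N"
      using that by (smt (verit) divide_nonneg_pos real_sqrt_ge_zero of_nat_0_le_iff)
    define I where "I = (UNIV :: 'k set) \<rightarrow>\<^sub>E {..N}"
    define Q :: "('k \<Rightarrow> nat) \<Rightarrow> (real^'k) set" where
      "Q = (\<lambda>f. cbox (\<chi> i. real (f i) / N) (\<chi> i. (real (f i) + 1) / N))"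
    have diam: "diameter (Q f) = ?s / N" for f
    proof -
      have "diameter (Q f) = dist (\<chi> i. real (f i) / N) ((\<chi> i. (real (f i) + 1) / N) :: real^'k)"
        unfolding Q_def using \<open>0 < real N\<close>
        by (intro diameter_cbox) (auto simp: Basis_vec_def inner_axis divide_right_mono)
      also have "\<dots> = ?s / N"
        using \<open>0 < real N\<close>
        by (simp add: dist_vec_def L2_set_def dist_real_def diff_divide_distrib[symmetric]
            real_sqrt_divide power_divide real_sqrt_mult)
      finally show ?thesis .
    qed
    have ne: "Q f \<noteq> {}" for f
      using \<open>0 < real N\<close> by (auto simp: Q_def box_ne_empty Basis_vec_def inner_axis divide_right_mono)
    have "cbox 0 1 \<subseteq> (\<Union>f\<in>I. Q f)"
    proof
      fix x :: "real^'k" assume "x \<in> cbox 0 1"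
      then have x: "0 \<le> x $ i" "x $ i \<le> 1" for i
        by (auto simp: mem_box_cart)
      define f where "f = (\<lambda>i. nat \<lfloor>N * x $ i\<rfloor>)"
      have f: "real (f i) \<le> N * x $ i" "N * x $ i \<le> real (f i) + 1" for i
      proof -
        have "real (f i) = of_int \<lfloor>N * x $ i\<rfloor>"
          using x(1)[of i] by (simp add: f_def)
        then show "real (f i) \<le> N * x $ i" "N * x $ i \<le> real (f i) + 1"
          by linarith+
      qed
      have "f i \<le> N" for i
      proof -
        have "real (f i) \<le> N * 1"
          using f(1)[of i] mult_left_mono[OF x(2)[of i], of "real N"] by linarith
        then show ?thesis by simp
      qed
      then have "f \<in> I" by (auto simp: I_def)
      moreover have "x \<in> Q f"
        using f \<open>0 < real N\<close> by (auto simp: Q_def mem_box_cart field_simps)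
      ultimately show "x \<in> (\<Union>f\<in>I. Q f)" by blast
    qed
    moreover have "finite I" by (auto simp: I_def intro: finite_PiE)
    moreover have "?s / N \<le> \<delta>"
      using N that \<open>0 < real N\<close> by (simp add: field_simps)
    ultimately have "hausdorff_pre ?k \<delta> (cbox 0 1 :: (real^'k) set) \<le> (\<Sum>f\<in>I. hausdorff_gauge ?k (Q f))"
      using that by (intro hausdorff_pre_le_finite_cover) (auto simp: diam, auto simp: Q_def)
    also have "\<dots> = ennreal (real (card I) * (unit_ball_vol (real ?k) * (?s / N / 2) ^ ?k))"
      using ne by (simp add: hausdorff_gauge_def diam ennreal_mult ennreal_of_nat_eq_real_of_nat)
    also have "\<dots> \<le> ennreal C"
    proof (rule ennreal_leI)
      have "real (card I) = (real N + 1) ^ ?k"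
        by (simp add: I_def card_funcsetE add.commute)
      also have "\<dots> \<le> (2 * real N) ^ ?k"
        using \<open>0 < real N\<close> by (intro power_mono) auto
      finally have "real (card I) * (unit_ball_vol (real ?k) * (?s / N / 2) ^ ?k) \<le>
          (2 * real N) ^ ?k * (unit_ball_vol (real ?k) * (?s / N / 2) ^ ?k)"
        by (intro mult_right_mono) auto
      also have "\<dots> = unit_ball_vol (real ?k) * ((2 * real N) * (?s / N / 2)) ^ ?k"
        by (simp only: power_mult_distrib mult_ac)
      also have "\<dots> = C"
        using \<open>0 < real N\<close> by (simp add: C_def)
      finally show "real (card I) * (unit_ball_vol (real ?k) * (?s / N / 2) ^ ?k) \<le> C" .
    qed
    finally show ?thesis .
  qed
  then have "hausdorff_outer ?k (cbox 0 1 :: (real^'k) set) \<le> ennreal C"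
    unfolding hausdorff_outer_def by (intro SUP_least) auto
  then show ?thesis
    using ennreal_less_top le_less_trans by blast
qed

lemma hausdorff_outer_translation:
  fixes A :: "'a::real_normed_vector set"
  shows "hausdorff_outer k ((+) a ` A) = hausdorff_outer k A"
  by (rule hausdorff_outer_isometric_image) simp

text \<open>The factor stays abstract: ratios of areas do not depend on it.\<close>

lemma hausdorff_measure_eq_scaled_lborel:
  "\<exists>\<kappa>. \<forall>A\<in>sets borel. emeasure (hausdorff_measure CARD('k)) A = \<kappa> * emeasure lborel (A :: (real^'k) set)"
proof (rule translation_invariant_measure_eq_scaled_lborel)
  show "sets (hausdorff_measure CARD('k)) = sets (borel :: (real^'k) measure)"
    by simp
  show "emeasure (hausdorff_measure CARD('k)) ((+) a ` A) = emeasure (hausdorff_measure CARD('k)) A"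
    if "A \<in> sets borel" for a and A :: "(real^'k) set"
  proof -
    have "(+) a ` A = (\<lambda>x. x - a) -` A"
      by (force simp: image_iff)
    also have "\<dots> \<in> sets borel"
      using that measurable_sets_borel[of "\<lambda>x. x - a" borel A] by simp
    finally show ?thesis
      using that by (simp add: emeasure_hausdorff_measure hausdorff_outer_translation)
  qed
  show "sigma_finite_measure (hausdorff_measure CARD('k) :: (real^'k) measure)"
  proof
    obtain D :: "(real^'k) set" where D: "countable D" "\<And>X. open X \<Longrightarrow> X \<noteq> {} \<Longrightarrow> \<exists>d\<in>D. d \<in> X"
      using countable_dense_setE by blast
    \<comment> \<open>unit cubes with a corner in a countable dense set cover the whole space\<close>
    define \<A> where "\<A> = (\<lambda>d. (+) d ` cbox 0 (1 :: real^'k)) ` D"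
    have "x \<in> \<Union>\<A>" for x
    proof -
      have "open (box (x - 1) x)" "box (x - 1) x \<noteq> {}"
        by (auto simp: box_ne_empty Basis_vec_def inner_axis algebra_simps)
      then obtain d where "d \<in> D" "d \<in> box (x - 1) x"
        using D(2) by blast
      then have "x - d \<in> cbox 0 1"
        by (auto simp: mem_box_cart less_imp_le algebra_simps)
      then show ?thesis
        using \<open>d \<in> D\<close> unfolding \<A>_def
        by (intro UnionI[OF imageI[of d]] image_eqI[of _ _ "x - d"]) auto
    qed
    moreover have "\<A> \<subseteq> sets borel"
      by (auto simp: \<A>_def intro!: borel_closed closed_translation)
    moreover have "emeasure (hausdorff_measure CARD('k)) A \<noteq> top" if "A \<in> \<A>" for A
      using that \<open>\<A> \<subseteq> sets borel\<close> hausdorff_outer_unit_cube_finite[where 'k='k]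
      by (auto simp: emeasure_hausdorff_measure hausdorff_outer_translation \<A>_def)
    ultimately show "\<exists>A. countable A \<and> A \<subseteq> sets (hausdorff_measure CARD('k) :: (real^'k) measure) \<and>
        \<Union>A = space (hausdorff_measure CARD('k)) \<and>
        (\<forall>a\<in>A. emeasure (hausdorff_measure CARD('k)) a \<noteq> \<infinity>)"
      using D(1) by (intro exI[of _ \<A>]) (auto simp: \<A>_def)
  qed
qed

text \<open>Being proportional to Lebesgue measure, the Hausdorff measure
  inherits its transformation law. The unknown factor is the same on both sides.\<close>

lemma hausdorff_outer_linear_image:
  fixes f :: "real^'k::{finite,wellorder} \<Rightarrow> real^'k::_"
  assumes "linear f" "compact S"
  shows "enn2real (hausdorff_outer CARD('k) (f ` S)) =
    \<bar>det (matrix f)\<bar> * enn2real (hausdorff_outer CARD('k) S)"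
proof -
  obtain \<kappa> where \<kappa>: "\<And>A :: (real^'k::_) set. A \<in> sets borel \<Longrightarrow>
      emeasure (hausdorff_measure CARD('k)) A = \<kappa> * emeasure lborel A"
    using hausdorff_measure_eq_scaled_lborel by blast
  have H: "enn2real (hausdorff_outer CARD('k) A) = enn2real \<kappa> * measure lebesgue A"
    if "compact A" for A :: "(real^'k::_) set"
    using that \<kappa>[of A] emeasure_hausdorff_measure[of A "CARD('k)"]
    by (simp add: borel_compact enn2real_mult measure_completion measure_def)
  have "compact (f ` S)"
    using assms by (intro compact_continuous_image linear_continuous_on)
       (auto simp: linear_conv_bounded_linear)
  then show ?thesis
    using assms by (simp add: H measure_linear_image lmeasurable_compact)
qed

section \<open>Tangential gradients of affine functions\<close>

lemma subspace_tangent_space: "subspace (tangent_space \<sigma>)"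
  by (simp add: tangent_space_def)

lemma diff_in_tangent_space: "x \<in> \<sigma> \<Longrightarrow> y \<in> \<sigma> \<Longrightarrow> x - y \<in> tangent_space \<sigma>"
  unfolding tangent_space_def by (rule span_base) blast

lemma dim_tangent_space:
  assumes "k simplex \<sigma>" "\<sigma> \<noteq> {}"
  shows "int (dim (tangent_space \<sigma>)) = k"
proof -
  obtain p where "p \<in> \<sigma>" using assms(2) by blast
  have "{x - y | x y. x \<in> \<sigma> \<and> y \<in> \<sigma>} \<subseteq> span ((+) (- p) ` \<sigma>)"
  proof clarify
    fix x y assume "x \<in> \<sigma>" "y \<in> \<sigma>"
    then have "(- p + x) - (- p + y) \<in> span ((+) (- p) ` \<sigma>)"
      by (intro span_diff span_base imageI)
    then show "x - y \<in> span ((+) (- p) ` \<sigma>)" by simp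
  qed
  moreover have "(+) (- p) ` \<sigma> \<subseteq> tangent_space \<sigma>"
    using diff_in_tangent_space[OF _ \<open>p \<in> \<sigma>\<close>] by auto
  ultimately have "tangent_space \<sigma> = span ((+) (- p) ` \<sigma>)"
    unfolding tangent_space_def by (simp add: span_minimal antisym)
  then have "int (dim (tangent_space \<sigma>)) = aff_dim \<sigma>"
    using aff_dim_eq_dim[of p \<sigma>] \<open>p \<in> \<sigma>\<close> by (simp add: hull_inc)
  then show ?thesis
    using aff_dim_simplex[OF assms(1)] by simp
qed

text \<open>A simplex of dimension below \<open>d\<close> has empty interior, so a derivative within it is
  determined only along its tangent space. Differentiation along the segments from \<open>x\<close> to the other
  points of \<open>\<sigma>\<close> shows that two candidates differ by a vector orthogonal to that space, and as both lie
  in it, they agree.\<close>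

lemma tangential_gradient_eqI:
  assumes "convex \<sigma>" "x \<in> \<sigma>" "g \<in> tangent_space \<sigma>"
    and f: "\<And>y. y \<in> \<sigma> \<Longrightarrow> f y = f x + g \<bullet> (y - x)"
  shows "tangential_gradient \<sigma> f x = g"
  unfolding tangential_gradient_def
proof (rule the_equality)
  have "((\<lambda>y. f x + g \<bullet> (y - x)) has_derivative (\<lambda>h. g \<bullet> h)) (at x within \<sigma>)"
    by (auto intro!: derivative_eq_intros)
  then have "(f has_derivative (\<lambda>h. g \<bullet> h)) (at x within \<sigma>)"
    by (rule has_derivative_transform[OF \<open>x \<in> \<sigma>\<close> f, rotated])
  with assms(3) show "g \<in> tangent_space \<sigma> \<and> (f has_derivative (\<lambda>h. g \<bullet> h)) (at x within \<sigma>)" ..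
next
  fix g' assume g': "g' \<in> tangent_space \<sigma> \<and> (f has_derivative (\<lambda>h. g' \<bullet> h)) (at x within \<sigma>)"
  have orth: "(g' - g) \<bullet> (z - x) = 0" if "z \<in> \<sigma>" for z
  proof -
    define l where "l = (\<lambda>t. x + t *\<^sub>R (z - x))"
    have l: "l t \<in> \<sigma>" if "t \<in> {0..1}" for t
      using convexD_alt[OF assms(1,2) \<open>z \<in> \<sigma>\<close>, of t] that by (simp add: l_def algebra_simps)
    have "(l has_vector_derivative (z - x)) (at 0 within {0..1})"
      unfolding l_def by (auto intro!: derivative_eq_intros)
    moreover have "(f has_derivative (\<lambda>h. g' \<bullet> h)) (at (l 0) within l ` {0..1})"
      using g' l by (auto simp: l_def intro: has_derivative_subset)
    ultimately have "((f \<circ> l) has_vector_derivative (g' \<bullet> (z - x))) (at 0 within {0..1})"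
      by (rule vector_derivative_diff_chain_within)
    moreover have "((\<lambda>t. f x + t * (g \<bullet> (z - x))) has_vector_derivative (g \<bullet> (z - x))) (at 0 within {0..1})"
      by (auto intro!: derivative_eq_intros)
    then have "((f \<circ> l) has_vector_derivative (g \<bullet> (z - x))) (at 0 within {0..1})"
    proof (rule has_vector_derivative_transform[rotated 2])
      show "(f \<circ> l) t = f x + t * (g \<bullet> (z - x))" if "t \<in> {0..1}" for t
        using f[OF l[OF that]] by (simp add: l_def)
    qed simp
    ultimately have "g' \<bullet> (z - x) = g \<bullet> (z - x)"
      by (rule vector_derivative_unique_within[rotated])
         (simp add: at_within_Icc_at_right)
    then show ?thesis by (simp add: inner_diff_left)
  qed
  have "orthogonal (g' - g) w" if "w \<in> tangent_space \<sigma>" for w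
    using that unfolding tangent_space_def
  proof (rule orthogonal_to_span)
    fix w assume "w \<in> {x - y | x y. x \<in> \<sigma> \<and> y \<in> \<sigma>}"
    then obtain u v where "w = (u - x) - (v - x)" "u \<in> \<sigma>" "v \<in> \<sigma>" by auto
    then show "orthogonal (g' - g) w"
      using orth by (simp add: orthogonal_def inner_diff_right)
  qed
  moreover have "g' - g \<in> tangent_space \<sigma>"
    using g' assms(3) subspace_tangent_space by (blast intro: subspace_diff)
  ultimately have "orthogonal (g' - g) (g' - g)" .
  then show "g' = g"
    by (simp add: orthogonal_self)
qed

definition affine_fun_on :: "(real^'n) set \<Rightarrow> (real^'n \<Rightarrow> real) \<Rightarrow> bool" where
  "affine_fun_on \<sigma> f \<longleftrightarrow> (\<exists>a b. \<forall>x\<in>\<sigma>. f x = a \<bullet> x + b)"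

text \<open>The gradient is the orthogonal projection of the coefficient
  vector \<open>a\<close> to the tangent space.\<close>

lemma affine_fun_on_gradient_exists:
  assumes "affine_fun_on \<sigma> f"
  shows "\<exists>g\<in>tangent_space \<sigma>. \<forall>x\<in>\<sigma>. \<forall>y\<in>\<sigma>. f y - f x = g \<bullet> (y - x)"
proof -
  obtain a b where ab: "\<forall>x\<in>\<sigma>. f x = a \<bullet> x + b"
    using assms unfolding affine_fun_on_def by (elim exE)
  obtain g r where g: "g \<in> tangent_space \<sigma>" "\<And>w. w \<in> tangent_space \<sigma> \<Longrightarrow> orthogonal r w" "a = g + r"
    by (rule orthogonal_subspace_decomp_exists
        [of "{x - y | x y. x \<in> \<sigma> \<and> y \<in> \<sigma>}" a, folded tangent_space_def]) (rule that)
  show ?thesis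
  proof (intro bexI[OF _ g(1)] ballI)
    fix x y assume "x \<in> \<sigma>" "y \<in> \<sigma>"
    then show "f y - f x = g \<bullet> (y - x)"
      using g(2)[OF diff_in_tangent_space, of y x] bspec[OF ab, of x] bspec[OF ab, of y] g(3)
      by (simp add: orthogonal_def inner_diff_right inner_add_left)
  qed
qed

text \<open>For affine \<open>f\<close> this vector is unique, and if \<open>\<sigma>\<close> is convex, it is the value of
  \<^const>\<open>tangential_gradient\<close> at every point of \<open>\<sigma>\<close>.\<close>

definition affine_gradient :: "(real^'n) set \<Rightarrow> (real^'n \<Rightarrow> real) \<Rightarrow> real^'n" where
  "affine_gradient \<sigma> f = (SOME g. g \<in> tangent_space \<sigma> \<and> (\<forall>x\<in>\<sigma>. \<forall>y\<in>\<sigma>. f y - f x = g \<bullet> (y - x)))"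

lemma affine_gradient:
  assumes "affine_fun_on \<sigma> f"
  shows affine_gradient_in: "affine_gradient \<sigma> f \<in> tangent_space \<sigma>"
    and affine_gradient_diff: "\<And>x y. x \<in> \<sigma> \<Longrightarrow> y \<in> \<sigma> \<Longrightarrow> f y - f x = affine_gradient \<sigma> f \<bullet> (y - x)"
proof -
  obtain g where g: "g \<in> tangent_space \<sigma>" "\<forall>x\<in>\<sigma>. \<forall>y\<in>\<sigma>. f y - f x = g \<bullet> (y - x)"
    using affine_fun_on_gradient_exists[OF assms] by (elim bexE)
  have grad: "affine_gradient \<sigma> f \<in> tangent_space \<sigma> \<and>
      (\<forall>x\<in>\<sigma>. \<forall>y\<in>\<sigma>. f y - f x = affine_gradient \<sigma> f \<bullet> (y - x))"
    unfolding affine_gradient_def by (rule someI[of _ g]) (intro conjI g)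
  show "affine_gradient \<sigma> f \<in> tangent_space \<sigma>"
    using grad by (rule conjunct1)
  show "f y - f x = affine_gradient \<sigma> f \<bullet> (y - x)" if "x \<in> \<sigma>" "y \<in> \<sigma>" for x y
    using bspec[OF bspec[OF conjunct2[OF grad]]] that by this
qed

lemma tangential_gradient_affine:
  assumes "affine_fun_on \<sigma> f" "convex \<sigma>" "x \<in> \<sigma>"
  shows "tangential_gradient \<sigma> f x = affine_gradient \<sigma> f"
proof (rule tangential_gradient_eqI[OF assms(2,3) affine_gradient_in[OF assms(1)]])
  show "f y = f x + affine_gradient \<sigma> f \<bullet> (y - x)" if "y \<in> \<sigma>" for y
    using affine_gradient_diff[OF assms(1,3) that] by linarith
qed

lemma affine_gradient_eqI:
  assumes "convex \<sigma>" "\<sigma> \<noteq> {}" "affine_fun_on \<sigma> f" "g \<in> tangent_space \<sigma>"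
    and "\<And>x y. x \<in> \<sigma> \<Longrightarrow> y \<in> \<sigma> \<Longrightarrow> f y - f x = g \<bullet> (y - x)"
  shows "affine_gradient \<sigma> f = g"
proof -
  obtain x where "x \<in> \<sigma>" using assms(2) by blast
  have "tangential_gradient \<sigma> f x = g"
  proof (rule tangential_gradient_eqI[OF assms(1) \<open>x \<in> \<sigma>\<close> assms(4)])
    show "f y = f x + g \<bullet> (y - x)" if "y \<in> \<sigma>" for y
      using assms(5)[OF \<open>x \<in> \<sigma>\<close> that] by linarith
  qed
  then show ?thesis
    using tangential_gradient_affine[OF assms(3,1) \<open>x \<in> \<sigma>\<close>] by simp
qed

lemma set_lebesgue_integral_const_on:
  fixes c :: real
  assumes "A \<in> sets M" "\<And>x. x \<in> A \<Longrightarrow> f x = c"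
  shows "(LINT x:A|M. f x) = measure M A * c"
proof -
  have "(LINT x:A|M. f x) = (LINT x|M. indicator A x * c)"
    unfolding set_lebesgue_integral_def
    by (intro Bochner_Integration.integral_cong) (auto simp: assms(2) indicator_def)
  also have "\<dots> = measure M A * c"
    using sets.sets_into_space[OF assms(1)] by (simp add: Int_absorb2)
  finally show ?thesis .
qed

section \<open>The area of an affinely displaced simplex\<close>

lemma isometry_inner:
  assumes "linear g" "\<And>x. norm (g x) = norm x"
  shows "g x \<bullet> g y = x \<bullet> y"
  using assms(2)[of "x + y"] assms(2)[of x] assms(2)[of y] linear_add[OF assms(1), of x y]
  by (simp add: dot_norm)

lemma norm_vec_power2: "(norm (x :: real^'k))\<^sup>2 = (\<Sum>i\<in>UNIV. (x $ i)\<^sup>2)"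
  unfolding power2_norm_eq_inner inner_vec_def by (simp add: power2_eq_square)

text \<open>The Frobenius norm of a matrix, summed by rows and by columns: \<open>G i\<close>
  is expanded in the orthonormal basis \<open>g (axis j 1)\<close> of the range of \<open>g\<close>.\<close>

lemma sum_norm_gradient_rows:
  fixes g :: "real^'k \<Rightarrow> real^'n" and G :: "'m::finite \<Rightarrow> real^'n"
  assumes g: "linear g" "\<And>y. norm (g y) = norm y" and G: "\<And>i. G i \<in> range g"
  shows "(\<Sum>i\<in>UNIV. (norm (G i))\<^sup>2) = (\<Sum>j\<in>UNIV. (norm ((\<chi> i. G i \<bullet> g (axis j 1)) :: real^'m))\<^sup>2)"
proof -
  have "(norm (G i))\<^sup>2 = (\<Sum>j\<in>UNIV. (G i \<bullet> g (axis j 1))\<^sup>2)" for i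
  proof -
    obtain y where "G i = g y" using G by blast
    then show ?thesis
      by (simp add: g(2) isometry_inner[OF g] inner_axis norm_vec_power2)
  qed
  then have "(\<Sum>i\<in>UNIV. (norm (G i))\<^sup>2) = (\<Sum>i\<in>UNIV. \<Sum>j\<in>UNIV. (G i \<bullet> g (axis j 1))\<^sup>2)"
    by simp
  also have "\<dots> = (\<Sum>j\<in>UNIV. \<Sum>i\<in>UNIV. (G i \<bullet> g (axis j 1))\<^sup>2)"
    by (rule sum.swap)
  finally show ?thesis
    by (simp add: norm_vec_power2)
qed

text \<open>Orthonormal coordinates \<open>f\<close> on the tangent space and their inverse
  parametrisation \<open>g\<close>.\<close>

lemma tangent_space_isometry:
  assumes "int CARD('k) simplex (\<sigma> :: (real^'n) set)"
  obtains f :: "real^'n \<Rightarrow> real^'k" and g :: "real^'k \<Rightarrow> real^'n"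
  where "linear f" "linear g" "range g = tangent_space \<sigma>"
    "\<And>x. x \<in> tangent_space \<sigma> \<Longrightarrow> norm (f x) = norm x" "\<And>y. norm (g y) = norm y"
    "\<And>x. x \<in> tangent_space \<sigma> \<Longrightarrow> g (f x) = x"
proof -
  have "\<sigma> \<noteq> {}" using assms by auto
  then have "dim (tangent_space \<sigma>) = dim (UNIV :: (real^'k) set)"
    using dim_tangent_space[OF assms] by simp
  then show thesis
    using isometries_subspaces[OF subspace_tangent_space subspace_UNIV, of \<sigma>] that
    by (metis UNIV_I)
qed

lemma simplex_area_eq_hausdorff_outer:
  "compact \<sigma> \<Longrightarrow> simplex_area \<sigma> = enn2real (hausdorff_outer (CARD('n) - 1) (\<sigma> :: (real^'n) set))"
  by (simp add: simplex_area_def measure_def emeasure_hausdorff_measure borel_compact)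

text \<open>The differential of \<open>X\<close> along \<open>\<sigma>\<close> has rows \<open>G i\<close>. Its domain, the
  tangent space, and its range \<open>W\<close> both embed isometrically into \<open>\<real>\<^sup>k\<close>, so in these coordinates it
  becomes a square matrix \<open>L\<close> with the same Frobenius norm. Since isometries preserve the Hausdorff
  measure, the transformation law for \<open>L\<close> is that for \<open>X\<close>. The image may be degenerate, in which case
  \<open>L\<close> is singular.\<close>

lemma simplex_area_affine_image:
  fixes \<sigma> :: "(real^'n) set" and X :: "real^'n \<Rightarrow> real^'n"
  assumes k: "CARD('k::{finite,wellorder}) = CARD('n) - 1"
    and \<sigma>: "int CARD('k) simplex \<sigma>"
    and G: "\<And>i. G i \<in> tangent_space \<sigma>"
    and X: "\<And>x y i. x \<in> \<sigma> \<Longrightarrow> y \<in> \<sigma> \<Longrightarrow> X y $ i - X x $ i = G i \<bullet> (y - x)"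
  shows "\<exists>L :: ((real, 'k) vec, 'k) vec. simplex_area (X ` \<sigma>) = \<bar>det L\<bar> * simplex_area \<sigma> \<and>
    (\<Sum>i\<in>UNIV. \<Sum>j\<in>UNIV. (L $ i $ j)\<^sup>2) = (\<Sum>i\<in>UNIV. (norm (G i))\<^sup>2)"
proof -
  obtain f :: "real^'n \<Rightarrow> real^'k::_" and g :: "real^'k::_ \<Rightarrow> real^'n" where
    f: "linear f" "\<And>x. x \<in> tangent_space \<sigma> \<Longrightarrow> norm (f x) = norm x" and
    g: "linear g" "\<And>y. norm (g y) = norm y" and
    range_g: "range g = tangent_space \<sigma>" and gf: "\<And>x. x \<in> tangent_space \<sigma> \<Longrightarrow> g (f x) = x"
    using tangent_space_isometry[OF \<sigma>] by metis
  obtain p where p: "p \<in> \<sigma>" using \<sigma> by fastforce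
  define D :: "real^'n \<Rightarrow> real^'n" where "D = (\<lambda>w. \<chi> i. G i \<bullet> w)"
  have "linear D"
    by (rule linearI) (simp_all add: D_def vec_eq_iff inner_add_right)
  have XD: "X y - X x = D (y - x)" if "x \<in> \<sigma>" "y \<in> \<sigma>" for x y
    using X[OF that] by (simp add: D_def vec_eq_iff)
  define W where "W = range (D \<circ> g)"
  have lin: "linear (D \<circ> g)"
    using \<open>linear D\<close> g(1) by (simp add: linear_compose)
  have W: "subspace W"
    unfolding W_def by (rule linear_subspace_image[OF lin subspace_UNIV])
  have dimW: "dim W \<le> dim (UNIV :: (real^'k::_) set)"
    unfolding W_def by (rule dim_image_le[OF lin])
  obtain h :: "real^'n \<Rightarrow> real^'k::_" where h: "linear h" "\<And>w. w \<in> W \<Longrightarrow> norm (h w) = norm w"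
    by (rule isometry_subset_subspace[OF W subspace_UNIV dimW]) (rule that)
  have DW: "D w \<in> W" if "w \<in> tangent_space \<sigma>" for w
    using that unfolding range_g[symmetric] W_def by auto
  \<comment> \<open>\<open>D\<close> read in orthonormal coordinates of the tangent space and of \<open>W\<close>\<close>
  define L where "L = h \<circ> (D \<circ> g)"
  have "linear L"
    unfolding L_def by (intro linear_compose lin h(1))
  define S where "S = (\<lambda>x. f (x - p)) ` \<sigma>"
  have "compact \<sigma>" using \<sigma> by (rule compact_simplex)
  have "compact S"
    unfolding S_def
    by (rule compact_continuous_image[OF linear_continuous_on_compose[OF _ f(1)] \<open>compact \<sigma>\<close>])
       (intro continuous_intros)
  have LS: "L ` S = (\<lambda>z. h (z - X p)) ` (X ` \<sigma>)"
    unfolding S_def image_image L_def o_def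
    using p by (intro image_cong refl) (simp add: gf diff_in_tangent_space XD)
  have outer_S: "hausdorff_outer CARD('k) S = hausdorff_outer CARD('k) \<sigma>"
    unfolding S_def
  proof (rule hausdorff_outer_isometric_image)
    fix x y assume "x \<in> \<sigma>" "y \<in> \<sigma>"
    then show "dist (f (x - p)) (f (y - p)) = dist x y"
      using f(2)[OF diff_in_tangent_space, of x y] by (simp add: dist_norm flip: linear_diff[OF f(1)])
  qed
  have "hausdorff_outer CARD('k) (L ` S) = hausdorff_outer CARD('k) (X ` \<sigma>)"
    unfolding LS
  proof (rule hausdorff_outer_isometric_image)
    fix u v assume "u \<in> X ` \<sigma>" "v \<in> X ` \<sigma>"
    then have "u - v \<in> W"
      using DW[OF diff_in_tangent_space] by (auto simp: XD)
    then show "dist (h (u - X p)) (h (v - X p)) = dist u v"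
      using h(2) by (simp add: dist_norm flip: linear_diff[OF h(1)])
  qed
  moreover have "compact (X ` \<sigma>)"
  proof -
    have "X ` \<sigma> = (\<lambda>x. X p + D (x - p)) ` \<sigma>"
      using XD[OF p] by (intro image_cong refl) (metis add_diff_cancel_left' diff_add_cancel add.commute)
    also have "compact \<dots>"
      by (rule compact_continuous_image[OF continuous_on_add[OF continuous_on_const
              linear_continuous_on_compose[OF _ \<open>linear D\<close>]] \<open>compact \<sigma>\<close>])
         (intro continuous_intros)
    finally show ?thesis .
  qed
  moreover have "simplex_area A = enn2real (hausdorff_outer CARD('k) A)" if "compact A" for A :: "(real^'n) set"
    using simplex_area_eq_hausdorff_outer[OF that] by (simp only: k)
  ultimately have "simplex_area (X ` \<sigma>) = \<bar>det (matrix L)\<bar> * simplex_area \<sigma>"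
    using hausdorff_outer_linear_image[OF \<open>linear L\<close> \<open>compact S\<close>] \<open>compact \<sigma>\<close>
    by (simp add: outer_S)
  moreover have "(\<Sum>i\<in>UNIV. \<Sum>j\<in>UNIV. (matrix L $ i $ j)\<^sup>2) = (\<Sum>i\<in>UNIV. (norm (G i))\<^sup>2)"
  proof -
    have "(\<Sum>i\<in>UNIV. \<Sum>j\<in>UNIV. (matrix L $ i $ j)\<^sup>2) = (\<Sum>j\<in>UNIV. (norm (L (axis j 1)))\<^sup>2)"
      unfolding norm_vec_power2 by (subst sum.swap) (simp add: matrix_def)
    also have "\<dots> = (\<Sum>j\<in>UNIV. (norm (D (g (axis j 1))))\<^sup>2)"
      using h(2) by (simp add: L_def W_def)
    also have "\<dots> = (\<Sum>i\<in>UNIV. (norm (G i))\<^sup>2)"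
      unfolding D_def using G range_g by (subst sum_norm_gradient_rows[OF g]) auto
    finally show ?thesis .
  qed
  ultimately show ?thesis by blast
qed

text \<open>The differential of the identity is the identity of the tangent space,
  whose squared Frobenius norm is its dimension.\<close>

lemma sum_norm_gradient_id:
  fixes \<sigma> :: "(real^'n) set"
  assumes \<sigma>: "int CARD('k::finite) simplex \<sigma>"
    and G: "\<And>i. G i \<in> tangent_space \<sigma>"
    and id: "\<And>x y i. x \<in> \<sigma> \<Longrightarrow> y \<in> \<sigma> \<Longrightarrow> y $ i - x $ i = G i \<bullet> (y - x)"
  shows "(\<Sum>i\<in>UNIV. (norm (G i))\<^sup>2) = real CARD('k)"
proof -
  obtain f :: "real^'n \<Rightarrow> real^'k" and g :: "real^'k \<Rightarrow> real^'n" where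
    g: "linear g" "\<And>y. norm (g y) = norm y" and range_g: "range g = tangent_space \<sigma>"
    using tangent_space_isometry[OF \<sigma>] by metis
  define D :: "real^'n \<Rightarrow> real^'n" where "D = (\<lambda>w. \<chi> i. G i \<bullet> w)"
  have "linear D"
    by (rule linearI) (simp_all add: D_def vec_eq_iff inner_add_right)
  have "D w = w" if "w \<in> tangent_space \<sigma>" for w
  proof -
    have "D w = id w"
      using \<open>linear D\<close> linear_id
    proof (rule linear_eq_on)
      show "w \<in> span {x - y | x y. x \<in> \<sigma> \<and> y \<in> \<sigma>}"
        using that by (simp add: tangent_space_def)
      show "D b = id b" if "b \<in> {x - y | x y. x \<in> \<sigma> \<and> y \<in> \<sigma>}" for b
      proof -
        from \<open>b \<in> _\<close> obtain x y where "b = x - y" "x \<in> \<sigma>" "y \<in> \<sigma>"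
          by blast
        moreover have "D (x - y) = x - y"
          using id[OF \<open>y \<in> \<sigma>\<close> \<open>x \<in> \<sigma>\<close>] by (simp add: D_def vec_eq_iff)
        ultimately show ?thesis
          by simp
      qed
    qed
    then show ?thesis by simp
  qed
  then have "norm (D (g (axis j 1))) = 1" for j
    using range_g g(2) by (metis norm_axis_1 rangeI)
  then show ?thesis
    using sum_norm_gradient_rows[OF g, of G] G range_g by (simp add: D_def)
qed

lemma simplex_area_nonneg: "0 \<le> simplex_area \<sigma>"
  by (simp add: simplex_area_def)

text \<open>This estimate and the next one bound the area element by the Dirichlet energy
  density. They are instances of \<open>\<bar>det L\<bar> \<le> 1 + (\<bar>L\<bar>\<^sup>2 - k) / 2\<close>, which follows from
  \<open>2 \<bar>a\<bar> \<bar>b\<bar> \<le> a\<^sup>2 + b\<^sup>2\<close> for \<open>k \<le> 2\<close>. It fails for \<open>k = 3\<close>, where \<open>det L\<close> grows like the cube of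
  \<open>L\<close>.\<close>

lemma abs_det_1_le:
  "\<bar>det (L :: real^1^1)\<bar> \<le> 1 + ((\<Sum>i\<in>UNIV. \<Sum>j\<in>UNIV. (L $ i $ j)\<^sup>2) - real CARD(1)) / 2"
  using zero_le_power2[of "\<bar>L $ 1 $ 1\<bar> - 1"]
  by (simp add: det_1 power2_eq_square field_simps)

lemma abs_det_2_le:
  "\<bar>det (L :: real^2^2)\<bar> \<le> 1 + ((\<Sum>i\<in>UNIV. \<Sum>j\<in>UNIV. (L $ i $ j)\<^sup>2) - real CARD(2)) / 2"
proof -
  have "\<bar>det L\<bar> \<le> \<bar>L $ 1 $ 1\<bar> * \<bar>L $ 2 $ 2\<bar> + \<bar>L $ 1 $ 2\<bar> * \<bar>L $ 2 $ 1\<bar>"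
    using abs_triangle_ineq4[of "L $ 1 $ 1 * L $ 2 $ 2" "L $ 1 $ 2 * L $ 2 $ 1"]
    by (simp add: det_2 abs_mult)
  then show ?thesis
    using zero_le_power2[of "\<bar>L $ 1 $ 1\<bar> - \<bar>L $ 2 $ 2\<bar>"] zero_le_power2[of "\<bar>L $ 1 $ 2\<bar> - \<bar>L $ 2 $ 1\<bar>"]
    by (simp add: sum_2 power2_diff power2_abs field_simps)
qed

section \<open>Dirichlet forms and the area of the displaced surface\<close>

lemma Sh_affine_fun_on: "f \<in> Sh \<G> \<Longrightarrow> \<sigma> \<in> \<G> \<Longrightarrow> affine_fun_on \<sigma> f"
  unfolding Sh_def affine_fun_on_def by blast

lemma Sh_vec_affine_fun_on: "v \<in> Sh_vec \<G> \<Longrightarrow> \<sigma> \<in> \<G> \<Longrightarrow> affine_fun_on \<sigma> (\<lambda>x. v x $ i)"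
  unfolding Sh_vec_def by (blast intro: Sh_affine_fun_on)

lemma affine_fun_on_component: "affine_fun_on \<sigma> (\<lambda>x. x $ i)"
  unfolding affine_fun_on_def by (intro exI[of _ "axis i 1"] exI[of _ 0]) (simp add: inner_axis')

lemma affine_gradient_add_scaled:
  fixes \<sigma> :: "(real^'n) set"
  assumes "convex \<sigma>" "\<sigma> \<noteq> {}" and f: "affine_fun_on \<sigma> f" and g: "affine_fun_on \<sigma> g"
  shows "affine_fun_on \<sigma> (\<lambda>x. t * f x + g x)"
    and "affine_gradient \<sigma> (\<lambda>x. t * f x + g x) = t *\<^sub>R affine_gradient \<sigma> f + affine_gradient \<sigma> g"
proof -
  obtain a b a' b' where "\<forall>x\<in>\<sigma>. f x = a \<bullet> x + b" "\<forall>x\<in>\<sigma>. g x = a' \<bullet> x + b'"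
    using f g unfolding affine_fun_on_def by (elim exE)
  then have "\<forall>x\<in>\<sigma>. t * f x + g x = (t *\<^sub>R a + a') \<bullet> x + (t * b + b')"
    by (simp add: inner_add_left algebra_simps)
  then show *: "affine_fun_on \<sigma> (\<lambda>x. t * f x + g x)"
    unfolding affine_fun_on_def by (intro exI)
  show "affine_gradient \<sigma> (\<lambda>x. t * f x + g x) = t *\<^sub>R affine_gradient \<sigma> f + affine_gradient \<sigma> g"
  proof (rule affine_gradient_eqI[OF assms(1,2) *])
    show "t *\<^sub>R affine_gradient \<sigma> f + affine_gradient \<sigma> g \<in> tangent_space \<sigma>"
      using f g by (intro subspace_add subspace_scale subspace_tangent_space affine_gradient_in)
    fix x y assume xy: "x \<in> \<sigma>" "y \<in> \<sigma>"
    have "t * f y + g y - (t * f x + g x) = t * (f y - f x) + (g y - g x)"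
      by (simp add: algebra_simps)
    also have "\<dots> = (t *\<^sub>R affine_gradient \<sigma> f + affine_gradient \<sigma> g) \<bullet> (y - x)"
      using affine_gradient_diff[OF f xy] affine_gradient_diff[OF g xy]
      by (simp add: inner_add_left)
    finally show "t * f y + g y - (t * f x + g x) =
        (t *\<^sub>R affine_gradient \<sigma> f + affine_gradient \<sigma> g) \<bullet> (y - x)" .
  qed
qed

lemma grad_form_eq_sum:
  fixes f g :: "real^'n \<Rightarrow> real"
  assumes "\<And>\<sigma>. \<sigma> \<in> \<G> \<Longrightarrow> compact \<sigma> \<and> convex \<sigma> \<and> affine_fun_on \<sigma> f \<and> affine_fun_on \<sigma> g"
  shows "grad_form \<G> f g = (\<Sum>\<sigma>\<in>\<G>. simplex_area \<sigma> * (affine_gradient \<sigma> f \<bullet> affine_gradient \<sigma> g))"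
  unfolding grad_form_def simplex_area_def
  using assms
  by (intro sum.cong refl set_lebesgue_integral_const_on)
     (auto simp: borel_compact tangential_gradient_affine)

lemma grad_form_vec_eq_sum:
  fixes u v :: "real^'n \<Rightarrow> real^'n"
  assumes "\<And>\<sigma>. \<sigma> \<in> \<G> \<Longrightarrow> compact \<sigma> \<and> convex \<sigma>"
    and "\<And>\<sigma> i. \<sigma> \<in> \<G> \<Longrightarrow> affine_fun_on \<sigma> (\<lambda>x. u x $ i)"
    and "\<And>\<sigma> i. \<sigma> \<in> \<G> \<Longrightarrow> affine_fun_on \<sigma> (\<lambda>x. v x $ i)"
  shows "grad_form_vec \<G> u v = (\<Sum>\<sigma>\<in>\<G>. simplex_area \<sigma> *
    (\<Sum>i\<in>UNIV. affine_gradient \<sigma> (\<lambda>x. u x $ i) \<bullet> affine_gradient \<sigma> (\<lambda>x. v x $ i)))"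
  unfolding grad_form_vec_def simplex_area_def
  using assms
  by (intro sum.cong refl set_lebesgue_integral_const_on)
     (auto simp: borel_compact tangential_gradient_affine)

lemma grad_form_self_nonneg:
  fixes f :: "real^'n \<Rightarrow> real"
  assumes "\<And>\<sigma>. \<sigma> \<in> \<G> \<Longrightarrow> compact \<sigma> \<and> convex \<sigma> \<and> affine_fun_on \<sigma> f"
  shows "0 \<le> grad_form \<G> f f"
  using assms by (subst grad_form_eq_sum) (auto intro!: sum_nonneg simp: simplex_area_nonneg)

text \<open>Write \<open>E\<close>, \<open>V\<close>, \<open>G = E + \<tau> V\<close> for the gradients of the identity, of \<open>v\<close>
  and of the displaced position. By the determinant estimate the area grows by at most the factor
  \<open>1 + (\<bar>G\<bar>\<^sup>2 - \<bar>E\<bar>\<^sup>2) / 2\<close>, because \<open>\<bar>E\<bar>\<^sup>2 = k\<close>. Convexity of the square gives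
  \<open>(\<bar>G\<bar>\<^sup>2 - \<bar>E\<bar>\<^sup>2) / 2 \<le> G \<bullet> (G - E) = \<tau> G \<bullet> V\<close>, where the gradient of the position is taken implicitly,
  exactly as in the scheme.\<close>

lemma simplex_area_moved_le:
  fixes \<sigma> :: "(real^'n) set" and v :: "real^'n \<Rightarrow> real^'n"
  assumes k: "CARD('k::{finite,wellorder}) = CARD('n) - 1"
    and det: "\<And>L :: ((real, 'k) vec, 'k) vec.
      \<bar>det L\<bar> \<le> 1 + ((\<Sum>i\<in>UNIV. \<Sum>j\<in>UNIV. (L $ i $ j)\<^sup>2) - real CARD('k)) / 2"
    and \<sigma>: "int CARD('k) simplex \<sigma>"
    and v: "\<And>i. affine_fun_on \<sigma> (\<lambda>x. v x $ i)"
  shows "simplex_area ((\<lambda>x. x + \<tau> *\<^sub>R v x) ` \<sigma>) \<le> simplex_area \<sigma> + \<tau> * (simplex_area \<sigma> *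
    (\<Sum>i\<in>UNIV. affine_gradient \<sigma> (\<lambda>x. (\<tau> *\<^sub>R v x + x) $ i) \<bullet> affine_gradient \<sigma> (\<lambda>x. v x $ i)))"
proof -
  have "\<sigma> \<noteq> {}" using \<sigma> by auto
  have "convex \<sigma>" using \<sigma> by (rule convex_simplex)
  define E :: "'n \<Rightarrow> real^'n" where "E = (\<lambda>i. affine_gradient \<sigma> (\<lambda>x. x $ i))"
  define V where "V = (\<lambda>i. affine_gradient \<sigma> (\<lambda>x. v x $ i))"
  define G where "G = (\<lambda>i. affine_gradient \<sigma> (\<lambda>x. (\<tau> *\<^sub>R v x + x) $ i))"
  have X: "affine_fun_on \<sigma> (\<lambda>x. (\<tau> *\<^sub>R v x + x) $ i)" and G: "G i = \<tau> *\<^sub>R V i + E i" for i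
    using affine_gradient_add_scaled[OF \<open>convex \<sigma>\<close> \<open>\<sigma> \<noteq> {}\<close> v affine_fun_on_component, of \<tau> i i]
    by (simp_all add: G_def V_def E_def)
  obtain L :: "((real, 'k) vec, 'k) vec" where
    L: "simplex_area ((\<lambda>x. x + \<tau> *\<^sub>R v x) ` \<sigma>) = \<bar>det L\<bar> * simplex_area \<sigma>"
      "(\<Sum>i\<in>UNIV. \<Sum>j\<in>UNIV. (L $ i $ j)\<^sup>2) = (\<Sum>i\<in>UNIV. (norm (G i))\<^sup>2)"
  proof -
    have "G i \<in> tangent_space \<sigma>" for i
      unfolding G_def by (rule affine_gradient_in[OF X])
    moreover have "(y + \<tau> *\<^sub>R v y) $ i - (x + \<tau> *\<^sub>R v x) $ i = G i \<bullet> (y - x)"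
      if "x \<in> \<sigma>" "y \<in> \<sigma>" for x y i
      using affine_gradient_diff[OF X that, of i] by (simp add: G_def add.commute)
    ultimately show thesis
      using simplex_area_affine_image[OF k \<sigma>, of G "\<lambda>x. x + \<tau> *\<^sub>R v x"] that by blast
  qed
  have E: "(\<Sum>i\<in>UNIV. (norm (E i))\<^sup>2) = real CARD('k)"
    unfolding E_def
    by (rule sum_norm_gradient_id[OF \<sigma>])
       (auto intro: affine_gradient_in affine_gradient_diff affine_fun_on_component)
  have pointwise: "(norm (G i))\<^sup>2 - (norm (E i))\<^sup>2 \<le> 2 * \<tau> * (G i \<bullet> V i)" for i
  proof -
    have "0 \<le> (norm (G i - E i))\<^sup>2" by simp
    also have "\<dots> = (norm (G i))\<^sup>2 + (norm (E i))\<^sup>2 - 2 * (G i \<bullet> E i)"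
      by (simp add: power2_norm_eq_inner inner_diff_left inner_diff_right inner_commute)
    finally have "(norm (G i))\<^sup>2 - (norm (E i))\<^sup>2 \<le> 2 * (G i \<bullet> (G i - E i))"
      by (simp add: power2_norm_eq_inner inner_diff_right)
    then show ?thesis by (simp add: G[of i])
  qed
  have "(\<Sum>i\<in>UNIV. (norm (G i))\<^sup>2) - real CARD('k) =
      (\<Sum>i\<in>UNIV. (norm (G i))\<^sup>2 - (norm (E i))\<^sup>2)"
    by (simp add: E sum_subtractf)
  also have "\<dots> \<le> (\<Sum>i\<in>UNIV. 2 * \<tau> * (G i \<bullet> V i))"
    by (rule sum_mono) (rule pointwise)
  also have "\<dots> = 2 * (\<tau> * (\<Sum>i\<in>UNIV. G i \<bullet> V i))"
    by (simp add: sum_distrib_left mult.assoc)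
  finally have "((\<Sum>i\<in>UNIV. (norm (G i))\<^sup>2) - real CARD('k)) / 2 \<le> \<tau> * (\<Sum>i\<in>UNIV. G i \<bullet> V i)"
    by simp
  then have "\<bar>det L\<bar> \<le> 1 + \<tau> * (\<Sum>i\<in>UNIV. G i \<bullet> V i)"
    using det[of L] unfolding L(2) by linarith
  then have "\<bar>det L\<bar> * simplex_area \<sigma> \<le> (1 + \<tau> * (\<Sum>i\<in>UNIV. G i \<bullet> V i)) * simplex_area \<sigma>"
    by (intro mult_right_mono simplex_area_nonneg)
  then show ?thesis
    unfolding L(1) by (simp add: G_def V_def algebra_simps)
qed

text \<open>Summation over the simplices. Two simplices might have the same image,
  which counts only once in the displaced surface, so its area is at most the sum over the original
  simplices.\<close>

lemma surface_area_moved_le: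
  fixes \<G> :: "(real^'n) set set" and v :: "real^'n \<Rightarrow> real^'n"
  assumes dim: "CARD('n) = 2 \<or> CARD('n) = 3"
    and \<G>: "closed_polyhedral_hypersurface \<G>" and v: "v \<in> Sh_vec \<G>"
  shows "surface_area ((\<lambda>\<sigma>. (\<lambda>x. x + \<tau> *\<^sub>R v x) ` \<sigma>) ` \<G>) \<le>
    surface_area \<G> + \<tau> * grad_form_vec \<G> (\<lambda>x. \<tau> *\<^sub>R v x + x) v"
proof -
  have fin: "finite \<G>" and simp: "\<And>\<sigma>. \<sigma> \<in> \<G> \<Longrightarrow> (int CARD('n) - 1) simplex \<sigma>"
    using \<G> by (auto simp: closed_polyhedral_hypersurface_def triangulation_def)
  have aff: "affine_fun_on \<sigma> (\<lambda>x. v x $ i)" if "\<sigma> \<in> \<G>" for \<sigma> i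
    using Sh_vec_affine_fun_on[OF v that] .
  have X: "affine_fun_on \<sigma> (\<lambda>x. (\<tau> *\<^sub>R v x + x) $ i)" if "\<sigma> \<in> \<G>" for \<sigma> i
    using affine_gradient_add_scaled(1)[OF convex_simplex[OF simp[OF that]] _ aff[OF that]
        affine_fun_on_component, of \<tau> i i] simp[OF that] dim
    by (cases "\<sigma> = {}") (auto simp: affine_fun_on_def)
  let ?D = "\<lambda>\<sigma>. \<Sum>i\<in>UNIV. affine_gradient \<sigma> (\<lambda>x. (\<tau> *\<^sub>R v x + x) $ i) \<bullet> affine_gradient \<sigma> (\<lambda>x. v x $ i)"
  have le: "simplex_area ((\<lambda>x. x + \<tau> *\<^sub>R v x) ` \<sigma>) \<le> simplex_area \<sigma> + \<tau> * (simplex_area \<sigma> * ?D \<sigma>)"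
    if "\<sigma> \<in> \<G>" for \<sigma>
    using dim
  proof
    assume "CARD('n) = 2"
    then show ?thesis
      using simp[OF that] by (intro simplex_area_moved_le[where 'k=1] abs_det_1_le aff[OF that]) auto
  next
    assume "CARD('n) = 3"
    then show ?thesis
      using simp[OF that] by (intro simplex_area_moved_le[where 'k=2] abs_det_2_le aff[OF that]) auto
  qed
  have "surface_area ((\<lambda>\<sigma>. (\<lambda>x. x + \<tau> *\<^sub>R v x) ` \<sigma>) ` \<G>) \<le>
      (\<Sum>\<sigma>\<in>\<G>. simplex_area ((\<lambda>x. x + \<tau> *\<^sub>R v x) ` \<sigma>))"
    unfolding surface_area_def
    using sum_image_le[OF fin, of simplex_area "\<lambda>\<sigma>. (\<lambda>x. x + \<tau> *\<^sub>R v x) ` \<sigma>"]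
    by (simp add: simplex_area_nonneg o_def)
  also have "\<dots> \<le> (\<Sum>\<sigma>\<in>\<G>. simplex_area \<sigma> + \<tau> * (simplex_area \<sigma> * ?D \<sigma>))"
    by (rule sum_mono) (rule le)
  also have "\<dots> = surface_area \<G> + \<tau> * (\<Sum>\<sigma>\<in>\<G>. simplex_area \<sigma> * ?D \<sigma>)"
    by (simp add: surface_area_def sum.distrib sum_distrib_left)
  also have "(\<Sum>\<sigma>\<in>\<G>. simplex_area \<sigma> * ?D \<sigma>) = grad_form_vec \<G> (\<lambda>x. \<tau> *\<^sub>R v x + x) v"
    using simp by (intro grad_form_vec_eq_sum[symmetric] X aff conjI)
      (auto intro: compact_simplex convex_simplex)
  finally show ?thesis .
qed

section \<open>Mass lumping and the stability of the scheme\<close>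

text \<open>The limit defining the lumped product at a vertex is meaningful
  because the vertex is approached from inside the simplex.\<close>

lemma simplex_islimpt_rel_interior:
  assumes "k simplex \<sigma>" "0 < k" "q \<in> \<sigma>"
  shows "q islimpt rel_interior \<sigma>"
proof -
  have "convex \<sigma>" "closed \<sigma>"
    using assms(1) by (auto intro: convex_simplex closed_simplex)
  then have closure: "closure (rel_interior \<sigma>) = \<sigma>"
    by (simp add: convex_closure_rel_interior)
  show ?thesis
  proof (cases "q \<in> rel_interior \<sigma>")
    case True
    have "rel_interior \<sigma> \<noteq> {q}"
    proof
      assume "rel_interior \<sigma> = {q}"
      then have "\<sigma> = {q}" using closure by simp
      then show False using assms(1,2) by simp
    qed
    then show ?thesis
      using True \<open>convex \<sigma>\<close>
      by (intro connected_imp_perfect convex_connected convex_rel_interior) auto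
  next
    case False
    then show ?thesis
      using assms(3) closure by (auto simp: closure_def)
  qed
qed

text \<open>The square root of a negative number is negative in HOL, so the sign of
  \<^const>\<open>lumped_norm\<close> depends on this. For continuous \<open>T\<close> the limits are the squared norms of the
  values at the vertices.\<close>

lemma lumped_self_nonneg:
  fixes T :: "real^'n \<Rightarrow> real^'n"
  assumes "CARD('n) \<ge> 2" and \<G>: "closed_polyhedral_hypersurface \<G>" and T: "T \<in> Sh_vec \<G>"
  shows "0 \<le> lumped \<G> T T"
proof -
  have "0 \<le> Lim (at q within rel_interior \<sigma>) (\<lambda>x. T x \<bullet> T x)"
    if "\<sigma> \<in> \<G>" "q \<in> vertices \<sigma>" for \<sigma> q
  proof -
    have \<sigma>: "(int CARD('n) - 1) simplex \<sigma>"
      using \<G> \<open>\<sigma> \<in> \<G>\<close> by (auto simp: closed_polyhedral_hypersurface_def)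
    have "q \<in> \<sigma>"
      using \<open>q \<in> vertices \<sigma>\<close> by (auto simp: vertices_def extreme_point_of_def)
    have "((\<lambda>x. T x $ i) \<longlongrightarrow> T q $ i) (at q within rel_interior \<sigma>)" for i
    proof -
      have "continuous_on (\<Union>\<G>) (\<lambda>x. T x $ i)"
        using T by (simp add: Sh_vec_def Sh_def)
      then have "((\<lambda>x. T x $ i) \<longlongrightarrow> T q $ i) (at q within \<Union>\<G>)"
        using \<open>q \<in> \<sigma>\<close> \<open>\<sigma> \<in> \<G>\<close> by (auto simp: continuous_on_def)
      then show ?thesis
        using rel_interior_subset[of \<sigma>] \<open>\<sigma> \<in> \<G>\<close> by (auto intro: tendsto_within_subset)
    qed
    then have "(T \<longlongrightarrow> T q) (at q within rel_interior \<sigma>)"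
      by (rule vec_tendstoI)
    then have "((\<lambda>x. T x \<bullet> T x) \<longlongrightarrow> T q \<bullet> T q) (at q within rel_interior \<sigma>)"
      by (intro tendsto_inner)
    moreover have "at q within rel_interior \<sigma> \<noteq> bot"
      using simplex_islimpt_rel_interior[OF \<sigma> _ \<open>q \<in> \<sigma>\<close>] assms(1)
      by (simp add: trivial_limit_within)
    ultimately have "Lim (at q within rel_interior \<sigma>) (\<lambda>x. T x \<bullet> T x) = T q \<bullet> T q"
      by (intro tendsto_Lim)
    then show ?thesis by simp
  qed
  then show ?thesis
    unfolding lumped_def
    by (intro mult_nonneg_nonneg sum_nonneg) (auto simp: simplex_area_nonneg)
qed

lemma lumped_cong_inner:
  assumes "\<And>x. \<eta> x \<bullet> \<xi> x = \<eta>' x \<bullet> \<xi>' x"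
  shows "lumped \<G> \<eta> \<xi> = lumped \<G> \<eta>' \<xi>'"
  unfolding lumped_def using assms by simp

theorem theorem2p7:
  fixes \<Gamma> :: "nat \<Rightarrow> (real^'n) set set"
    and n T v :: "nat \<Rightarrow> real^'n \<Rightarrow> real^'n"
    and lam :: "nat \<Rightarrow> real^'n \<Rightarrow> real"
    and c :: "nat \<Rightarrow> real"
    and \<tau> \<alpha> :: real
    and N :: nat
  assumes dim: "CARD('n) = 2 \<or> CARD('n) = 3"
    and tau: "\<tau> > 0"
    and alpha: "\<alpha> > 0"
    and surfaces: "\<And>m. m \<le> N \<Longrightarrow> closed_polyhedral_hypersurface (\<Gamma> m)"
    and normals: "\<And>m. m \<in> {1..N} \<Longrightarrow> oriented_unit_normal (\<Gamma> (m - 1)) (n (m - 1))"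
    and Th: "\<And>m. m \<in> {1..N} \<Longrightarrow> is_Th (\<Gamma> (m - 1)) (n (m - 1)) (T (m - 1))"
    and v_space: "\<And>m. m \<in> {1..N} \<Longrightarrow> v m \<in> Sh_vec (\<Gamma> (m - 1))"
    and lam_space: "\<And>m. m \<in> {1..N} \<Longrightarrow> lam m \<in> Sh (\<Gamma> (m - 1))"
    and eq1: "\<And>m \<eta>. m \<in> {1..N} \<Longrightarrow> \<eta> \<in> Sh_vec (\<Gamma> (m - 1)) \<Longrightarrow>
          grad_form_vec (\<Gamma> (m - 1)) (\<lambda>x. \<tau> *\<^sub>R v m x + x) \<eta>
          - lumped (\<Gamma> (m - 1)) (\<lambda>x. lam m x *\<^sub>R n (m - 1) x) \<eta>
          - c m * lumped (\<Gamma> (m - 1)) (T (m - 1)) \<eta> = 0"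
    and eq2: "\<And>m \<xi>. m \<in> {1..N} \<Longrightarrow> \<xi> \<in> Sh (\<Gamma> (m - 1)) \<Longrightarrow>
          lumped (\<Gamma> (m - 1)) (\<lambda>x. v m x \<bullet> n (m - 1) x) \<xi>
          + grad_form (\<Gamma> (m - 1)) (lam m) \<xi> = 0"
    and eq3: "\<And>m. m \<in> {1..N} \<Longrightarrow>
          lumped (\<Gamma> (m - 1)) (v m) (T (m - 1))
          + \<alpha> * c m * lumped_norm (\<Gamma> (m - 1)) (T (m - 1)) = 0"
    and moved: "\<And>m. m \<in> {1..N} \<Longrightarrow>
          \<Gamma> m = (\<lambda>\<sigma>. (\<lambda>x. x + \<tau> *\<^sub>R v m x) ` \<sigma>) ` \<Gamma> (m - 1)"
  shows "\<forall>m\<in>{1..N}. surface_area (\<Gamma> m) \<le> surface_area (\<Gamma> (m - 1))"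
proof
  fix m assume m: "m \<in> {1..N}"
  define \<G> where "\<G> = \<Gamma> (m - 1)"
  have \<G>: "closed_polyhedral_hypersurface \<G>"
    using m by (auto simp: \<G>_def intro: surfaces)
  have v: "v m \<in> Sh_vec \<G>" and lam: "lam m \<in> Sh \<G>"
    using v_space[OF m] lam_space[OF m] by (auto simp: \<G>_def)
  have T: "T (m - 1) \<in> Sh_vec \<G>"
    using Th[OF m] by (simp add: is_Th_def \<G>_def)
  have "lumped \<G> (\<lambda>x. lam m x *\<^sub>R n (m - 1) x) (v m) = lumped \<G> (\<lambda>x. v m x \<bullet> n (m - 1) x) (lam m)"
    by (rule lumped_cong_inner) (simp add: inner_commute)
  moreover have "lumped \<G> (T (m - 1)) (v m) = lumped \<G> (v m) (T (m - 1))"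
    by (rule lumped_cong_inner) (simp add: inner_commute)
  ultimately have "grad_form_vec \<G> (\<lambda>x. \<tau> *\<^sub>R v m x + x) (v m) =
      lumped \<G> (\<lambda>x. v m x \<bullet> n (m - 1) x) (lam m) + c m * lumped \<G> (v m) (T (m - 1))"
    using eq1[OF m, of "v m"] v by (simp add: \<G>_def)
  also have "lumped \<G> (\<lambda>x. v m x \<bullet> n (m - 1) x) (lam m) = - grad_form \<G> (lam m) (lam m)"
    using eq2[OF m, of "lam m"] lam by (simp add: \<G>_def)
  also have "lumped \<G> (v m) (T (m - 1)) = - (\<alpha> * c m * lumped_norm \<G> (T (m - 1)))"
    using eq3[OF m] by (simp add: \<G>_def)
  also have "c m * - (\<alpha> * c m * lumped_norm \<G> (T (m - 1))) =
      - (\<alpha> * (c m)\<^sup>2 * lumped_norm \<G> (T (m - 1)))"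
    by (simp add: power2_eq_square)
  finally have "grad_form_vec \<G> (\<lambda>x. \<tau> *\<^sub>R v m x + x) (v m) =
      - grad_form \<G> (lam m) (lam m) - \<alpha> * (c m)\<^sup>2 * lumped_norm \<G> (T (m - 1))"
    by simp
  moreover have "0 \<le> grad_form \<G> (lam m) (lam m)"
    using \<G> lam by (intro grad_form_self_nonneg)
      (auto simp: closed_polyhedral_hypersurface_def intro: compact_simplex convex_simplex Sh_affine_fun_on)
  moreover have "0 \<le> \<alpha> * (c m)\<^sup>2 * lumped_norm \<G> (T (m - 1))"
    using alpha dim lumped_self_nonneg[OF _ \<G> T] by (auto simp: lumped_norm_def)
  ultimately have "\<tau> * grad_form_vec \<G> (\<lambda>x. \<tau> *\<^sub>R v m x + x) (v m) \<le> 0"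
    using tau by (simp add: mult_le_0_iff)
  then show "surface_area (\<Gamma> m) \<le> surface_area (\<Gamma> (m - 1))"
    using surface_area_moved_le[OF dim \<G> v, of \<tau>] by (simp add: moved[OF m] \<G>_def)
qed

end
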